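(* Let $\delta,\lambda\in\mathbb{R}$ with $\lambda>0$. Then there exists a minimizer of the functional $E_{LM}\colon H^2_{imm}([0,2\pi];\mathbb{R}^2)\times H^1_{per}([0,2\pi];\mathbb{R}^2)\to\mathbb{R}$ subject to the constraints $\int_0^{2\pi}\gamma\,\mathrm{d}x=0$ and $\int_0^{2\pi}\eta\,\mathrm{d}x=0$; that is, there is a pair $(\gamma,\eta)\in H^2_{imm}\times H^1_{per}$ satisfying both constraints such that $E_{LM}(\gamma,\eta)\le E_{LM}(\tilde\gamma,\tilde\eta)$ for all $(\tilde\gamma,\tilde\eta)\in H^2_{imm}\times H^1_{per}$ satisfying both constraints.
   Context: Let $\langle\cdot,\cdot\rangle$ be the Euclidean inner product on $\mathbb{R}^2$ and $J$ the counterclockwise rotation by $\pi/2$. For $k\in\mathbb{N}=\{1,2,\dots\}$, $H^k_{per}([0,2\pi];\mathbb{R}^m)$ is the set of $f\in H^k([0,2\pi];\mathbb{R}^m)$ with $\partial_x^\ell f(0)=\partial_x^\ell f(2\pi)$ for $\ell=0,\dots,k-1$. $H^2_{imm}([0,2\pi];\mathbb{R}^2)$ is the set of $\gamma\in H^2_{per}([0,2\pi];\mathbb{R}^2)$ with $\partial_x\gamma(x)\neq0$ for all $x$. For $\gamma\in H^2_{imm}$: $\partial_s=|\partial_x\gamma|^{-1}\partial_x$, $\tau=\partial_s\gamma$, $\nu=J\tau$, the curvature $\kappa$ is defined by $\partial_s\tau=\kappa\nu$, $\int_\gamma f\,\mathrm{d}s=\int_0^{2\pi}f(x)|\partial_x\gamma(x)|\,\mathrm{d}x$,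 and $L(\gamma)=\int_\gamma1\,\mathrm{d}s$. For $\eta\in H^1_{per}([0,2\pi];\mathbb{R}^2)$: $\operatorname{div}_\gamma\eta=\langle\partial_s\eta,\tau\rangle$ and $\nabla_\gamma\eta=\partial_s\eta\otimes\tau$ (so $|\nabla_\gamma\eta|=|\partial_s\eta|$). The energy is $$E_{LM}(\gamma,\eta)=\frac12\int_\gamma(\kappa+\delta\operatorname{div}_\gamma\eta)^2\,\mathrm{d}s+\frac\lambda2\int_\gamma|\nabla_\gamma\eta|^2\,\mathrm{d}s+L(\gamma).$$ *)

theory Defs
  imports "HOL-Analysis.Analysis"
begin

abbreviation per_interval :: "real set" where
  "per_interval \<equiv> {0..2 * pi}"

abbreviation per_measure :: "real measure" where
  "per_measure \<equiv> lebesgue_on per_interval"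

definition L2_per :: "(real \<Rightarrow> 'a::euclidean_space) set" where
  "L2_per = {f. f \<in> borel_measurable per_measure \<and>
                integrable per_measure (\<lambda>x. (norm (f x))\<^sup>2)}"

definition test_functions :: "(real \<Rightarrow> real) set" where
  "test_functions = {\<phi>. (\<forall>n. (deriv ^^ n) \<phi> differentiable_on UNIV) \<and>
                        closure {x. \<phi> x \<noteq> 0} \<subseteq> {0<..<2 * pi}}"

definition has_weak_deriv ::
    "(real \<Rightarrow> 'a::euclidean_space) \<Rightarrow> (real \<Rightarrow> 'a) \<Rightarrow> bool" where
  "has_weak_deriv f g \<longleftrightarrow> f \<in> L2_per \<and> g \<in> L2_per \<and>
     (\<forall>\<phi>\<in>test_functions.
        (LINT x|per_measure. deriv \<phi> x *\<^sub>R f x) =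
        - (LINT x|per_measure. \<phi> x *\<^sub>R g x))"

text \<open>The spaces \<open>H\<^sup>k\<close> on the interval from \<open>0\<close> to \<open>2\<pi>\<close>, as sets of functions rather
  than of classes modulo null sets.  Values outside the interval are irrelevant.\<close>

primrec sobolev :: "nat \<Rightarrow> (real \<Rightarrow> 'a::euclidean_space) set" where
  "sobolev 0 = L2_per"
| "sobolev (Suc k) = {f. \<exists>g\<in>sobolev k. has_weak_deriv f g}"

text \<open>Two derivatives are used.  Pointwise conditions refer to the classical derivative
  (one-sided at the end points): the continuous representative of an element of \<open>H\<^sup>k\<close> is
  of class \<open>C\<^sup>k\<^sup>-\<^sup>1\<close> on the closed interval.  Expressions under an integral use the weak derivative, a
  chosen function that is determined up to null sets; the two agree almost everywhere.\<close>

definition dx :: "(real \<Rightarrow> 'a::euclidean_space) \<Rightarrow> real \<Rightarrow> 'a" where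
  "dx f x = vector_derivative f (at x within per_interval)"

definition weak_dx :: "(real \<Rightarrow> 'a::euclidean_space) \<Rightarrow> real \<Rightarrow> 'a" where
  "weak_dx f = (SOME g. has_weak_deriv f g)"

text \<open>For \<open>k \<ge> 1\<close>, an element of \<open>H\<^sup>k\<close> is given by its continuous representative.\<close>

definition sobolev_per :: "nat \<Rightarrow> (real \<Rightarrow> 'a::euclidean_space) set" where
  "sobolev_per k = {f \<in> sobolev k. continuous_on per_interval f \<and>
                      (\<forall>l<k. (dx ^^ l) f 0 = (dx ^^ l) f (2 * pi))}"

definition H2_imm :: "(real \<Rightarrow> real^2) set" where
  "H2_imm = {\<gamma> \<in> sobolev_per 2. \<forall>x\<in>per_interval. dx \<gamma> x \<noteq> 0}"

definition rot :: "real^2 \<Rightarrow> real^2" where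
  "rot v = vector [- v $ 2, v $ 1]"

definition ds ::
    "(real \<Rightarrow> real^2) \<Rightarrow> (real \<Rightarrow> 'a::euclidean_space) \<Rightarrow> real \<Rightarrow> 'a" where
  "ds \<gamma> f x = inverse (norm (weak_dx \<gamma> x)) *\<^sub>R weak_dx f x"

definition tangent :: "(real \<Rightarrow> real^2) \<Rightarrow> real \<Rightarrow> real^2" where
  "tangent \<gamma> = ds \<gamma> \<gamma>"

definition unit_normal :: "(real \<Rightarrow> real^2) \<Rightarrow> real \<Rightarrow> real^2" where
  "unit_normal \<gamma> x = rot (tangent \<gamma> x)"

text \<open>For an immersion of class \<open>H\<^sup>2\<close> the curvature is well defined almost everywhere.\<close>

definition curvature :: "(real \<Rightarrow> real^2) \<Rightarrow> real \<Rightarrow> real" where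
  "curvature \<gamma> x = (THE k. ds \<gamma> (tangent \<gamma>) x = k *\<^sub>R unit_normal \<gamma> x)"

definition curve_integral :: "(real \<Rightarrow> real^2) \<Rightarrow> (real \<Rightarrow> real) \<Rightarrow> real" where
  "curve_integral \<gamma> f = (LINT x|per_measure. f x * norm (weak_dx \<gamma> x))"

definition curve_length :: "(real \<Rightarrow> real^2) \<Rightarrow> real" where
  "curve_length \<gamma> = curve_integral \<gamma> (\<lambda>_. 1)"

definition curve_div :: "(real \<Rightarrow> real^2) \<Rightarrow> (real \<Rightarrow> real^2) \<Rightarrow> real \<Rightarrow> real" where
  "curve_div \<gamma> \<eta> x = ds \<gamma> \<eta> x \<bullet> tangent \<gamma> x"

text \<open>The norm on \<^typ>\<open>real^2^2\<close> is the Frobenius norm.\<close>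

definition curve_grad :: "(real \<Rightarrow> real^2) \<Rightarrow> (real \<Rightarrow> real^2) \<Rightarrow> real \<Rightarrow> real^2^2" where
  "curve_grad \<gamma> \<eta> x = (\<chi> i j. ds \<gamma> \<eta> x $ i * tangent \<gamma> x $ j)"

definition E_LM ::
    "real \<Rightarrow> real \<Rightarrow> (real \<Rightarrow> real^2) \<Rightarrow> (real \<Rightarrow> real^2) \<Rightarrow> real" where
  "E_LM \<delta> lam \<gamma> \<eta> =
     1 / 2 * curve_integral \<gamma> (\<lambda>x. (curvature \<gamma> x + \<delta> * curve_div \<gamma> \<eta> x)\<^sup>2)
     + lam / 2 * curve_integral \<gamma> (\<lambda>x. (norm (curve_grad \<gamma> \<eta> x))\<^sup>2)
     + curve_length \<gamma>"

definition admissible :: "((real \<Rightarrow> real^2) \<times> (real \<Rightarrow> real^2)) set" where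
  "admissible = {(\<gamma>, \<eta>). \<gamma> \<in> H2_imm \<and> \<eta> \<in> sobolev_per 1 \<and>
     (LINT x|per_measure. \<gamma> x) = 0 \<and> (LINT x|per_measure. \<eta> x) = 0}"

end

theory Submission
  imports Defs "HOL-Computational_Algebra.Polynomial"
begin

text \<open>
  There is an explicit minimizer, a circle.  Put \<open>\<mu> = \<lambda> / (\<lambda> + \<delta>\<^sup>2)\<close>.  Completing the square gives the pointwise
  bound \<open>(\<kappa> + \<delta> div \<eta>)\<^sup>2 + \<lambda> |\<nabla>\<eta>|\<^sup>2 \<ge> \<mu> \<kappa>\<^sup>2\<close>, and then \<open>\<mu> \<kappa>\<^sup>2 / 2 + 1 \<ge> 2 R |\<kappa>|\<close> for \<open>R = sqrt (\<mu> / 2)\<close> by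
  AM-GM.  As a closed curve has total absolute curvature at least \<open>2\<pi>\<close> (Fenchel), the energy is at least
  \<open>4\<pi>R\<close>.  All three inequalities are equalities for the circle of radius \<open>R\<close> and \<open>\<eta>\<close> a suitable
  multiple of its normal field.

  Since \<open>\<gamma>'\<close> is only weakly differentiable, its angle \<open>\<theta>\<close> is obtained as the imaginary part of an integral of \<open>\<gamma>''/\<gamma>'\<close>.
\<close>

section \<open>Indefinite integrals\<close>

text \<open>The lower bound is attainable because \<open>\<kappa> \<tau>\<close> is, up to sign, the
  arc length derivative of \<open>\<nu>\<close>: the field that is optimal for a given closed curve
  has \<open>\<partial>_s \<eta> = - \<delta> \<kappa> \<tau> / (\<lambda> + \<delta>^2)\<close>,
  which is a constant times the derivative of the normal, so periodicity of \<open>\<eta>\<close>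
  costs nothing. The coupling therefore only rescales the bending term by \<open>\<mu>\<close>, and
  equality in AM-GM then forces \<open>|\<kappa>| = 1 / R\<close>. The obstacle is regularity. The
  energy sees chosen weak derivatives, known up to null sets, while periodicity and the immersion
  condition are pointwise. Indefinite integrals of integrable densities are the notion in which both
  can be expressed: they are continuous, they obey a product rule and an exponential rule, and the
  weak derivative of a continuous function is exactly such a density.\<close>

lemma eq_endpoints_if_locally_small:
  fixes H :: "real \<Rightarrow> 'a::real_normed_vector" and M :: "real \<Rightarrow> real"
  assumes "a \<le> b"
    and small: "\<And>e. e > 0 \<Longrightarrow> \<exists>d>0. \<forall>x\<in>{a..b}. \<forall>y\<in>{a..b}. x \<le> y \<longrightarrow> y - x < d \<longrightarrow>
                  norm (H y - H x) \<le> e * (M y - M x)"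
  shows "H b = H a"
proof -
  \<comment> \<open>Cut \<open>{a..b}\<close> into \<open>n\<close> equal pieces shorter than
    \<open>d\<close>. The local bounds add up, and the increments of \<open>M\<close> telescope to a
    total independent of the mesh, so that \<open>e\<close> can be sent to 0. In the product and
    exponential rules \<open>M\<close> is the integral of the norms of the densities.\<close>
  have le: "norm (H b - H a) \<le> e * (M b - M a)" if "e > 0" for e
  proof -
    obtain d where "d > 0" and d: "\<And>x y. \<lbrakk>x \<in> {a..b}; y \<in> {a..b}; x \<le> y; y - x < d\<rbrakk> \<Longrightarrow>
                  norm (H y - H x) \<le> e * (M y - M x)"
      using small[OF \<open>e > 0\<close>] by blast
    obtain n where n: "(b - a) / d < real n"
      using reals_Archimedean2 by blast
    have npos: "0 < real n"
      using n \<open>a \<le> b\<close> \<open>d > 0\<close> by (smt (verit) divide_nonneg_pos)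
    define t where "t i = a + real i * ((b - a) / n)" for i :: nat
    have step: "t (Suc i) - t i = (b - a) / n" for i
      by (simp add: t_def algebra_simps add_divide_distrib diff_divide_distrib)
    have t0: "t 0 = a" and tn: "t n = b"
      using npos by (simp_all add: t_def)
    have "(b - a) / n < d"
      using n npos \<open>d > 0\<close> by (simp add: field_simps)
    have mem: "t i \<in> {a..b}" if "i \<le> n" for i
    proof -
      have "real i * ((b - a) / n) \<le> real n * ((b - a) / n)"
        using that \<open>a \<le> b\<close> by (intro mult_right_mono) auto
      then show ?thesis
        using \<open>a \<le> b\<close> npos by (simp add: t_def)
    qed
    have "norm (H b - H a) = norm (\<Sum>i<n. H (t (Suc i)) - H (t i))"
      by (simp add: sum_lessThan_telescope[of "\<lambda>i. H (t i)"] t0 tn)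
    also have "\<dots> \<le> (\<Sum>i<n. e * (M (t (Suc i)) - M (t i)))"
    proof (rule sum_norm_le)
      fix i assume "i \<in> {..<n}"
      moreover have "t i \<le> t (Suc i)"
        using step[of i] \<open>a \<le> b\<close> npos by (smt (verit) divide_nonneg_pos)
      ultimately show "norm (H (t (Suc i)) - H (t i)) \<le> e * (M (t (Suc i)) - M (t i))"
        using mem[of i] mem[of "Suc i"] step[of i] \<open>(b - a) / n < d\<close> \<open>a \<le> b\<close> npos
        by (intro d) (auto simp flip: step)
    qed
    also have "\<dots> = e * (M b - M a)"
      by (simp add: sum_lessThan_telescope[of "\<lambda>i. M (t i)"] t0 tn flip: sum_distrib_left)
    finally show ?thesis .
  qed
  have "norm (H b - H a) \<le> 0"
  proof (rule field_le_epsilon)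
    fix e :: real assume "e > 0"
    define C where "C = \<bar>M b - M a\<bar> + 1"
    have "C > 0" "M b - M a \<le> C" by (auto simp: C_def)
    have "norm (H b - H a) \<le> e / C * (M b - M a)"
      using \<open>e > 0\<close> \<open>C > 0\<close> by (intro le) auto
    also have "\<dots> \<le> e / C * C"
      using \<open>e > 0\<close> \<open>C > 0\<close> \<open>M b - M a \<le> C\<close> by (intro mult_left_mono) auto
    finally show "norm (H b - H a) \<le> 0 + e" using \<open>C > 0\<close> by simp
  qed
  then show ?thesis by simp
qed

text \<open>The substitute for absolute continuity.\<close>

definition primitive_on :: "real \<Rightarrow> real \<Rightarrow> (real \<Rightarrow> 'a::euclidean_space) \<Rightarrow> (real \<Rightarrow> 'a) \<Rightarrow> bool" where
  "primitive_on a b F f \<longleftrightarrow>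
     f absolutely_integrable_on {a..b} \<and> (\<forall>x\<in>{a..b}. F x = F a + integral {a..x} f)"

lemma absolutely_integrable_subinterval_real:
  fixes f :: "real \<Rightarrow> 'a::euclidean_space"
  assumes "f absolutely_integrable_on {a..b}" "a \<le> x" "y \<le> b"
  shows "f absolutely_integrable_on {x..y}"
  using absolutely_integrable_on_subinterval[OF assms(1), of x y] assms(2,3) by auto

lemma primitive_on_absolutely_integrable:
  "primitive_on a b F f \<Longrightarrow> f absolutely_integrable_on {a..b}"
  by (simp add: primitive_on_def)

lemma primitive_on_integrable:
  "primitive_on a b F f \<Longrightarrow> f integrable_on {a..b}"
  by (simp add: primitive_on_def absolutely_integrable_on_def)

lemma primitive_on_eq:
  "primitive_on a b F f \<Longrightarrow> x \<in> {a..b} \<Longrightarrow> F x = F a + integral {a..x} f"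
  unfolding primitive_on_def by blast

lemma primitive_on_subinterval_integrable:
  "primitive_on a b F f \<Longrightarrow> a \<le> x \<Longrightarrow> y \<le> b \<Longrightarrow> f absolutely_integrable_on {x..y}"
  by (blast intro: absolutely_integrable_subinterval_real primitive_on_absolutely_integrable)

lemma primitive_on_diff:
  assumes "primitive_on a b F f" "a \<le> x" "x \<le> y" "y \<le> b"
  shows "F y - F x = integral {x..y} f"
proof -
  have "f integrable_on {a..y}"
    using primitive_on_subinterval_integrable[OF assms(1), of a y] assms
    by (simp add: absolutely_integrable_on_def)
  then have "integral {a..x} f + integral {x..y} f = integral {a..y} f"
    using assms by (intro Henstock_Kurzweil_Integration.integral_combine) auto
  then show ?thesis
    using assms primitive_on_eq[OF assms(1), of x] primitive_on_eq[OF assms(1), of y] by (simp add: algebra_simps)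
qed

lemma primitive_on_norm_diff:
  assumes "primitive_on a b F f" "a \<le> x" "x \<le> y" "y \<le> b"
  shows "norm (F y - F x) \<le> integral {x..y} (\<lambda>t. norm (f t))"
proof -
  have "f absolutely_integrable_on {x..y}"
    using primitive_on_subinterval_integrable[OF assms(1)] assms by simp
  then show ?thesis
    unfolding primitive_on_diff[OF assms]
    by (intro Henstock_Kurzweil_Integration.integral_norm_bound_integral)
       (auto simp: absolutely_integrable_on_def)
qed

lemma primitive_on_continuous:
  assumes "primitive_on a b F f"
  shows "continuous_on {a..b} F"
proof -
  have "continuous_on {a..b} (\<lambda>x. F a + integral {a..x} f)"
    using primitive_on_integrable[OF assms]
    by (intro continuous_on_add continuous_on_const indefinite_integral_continuous_1)
  then show ?thesis
    by (rule continuous_on_eq) (rule primitive_on_eq[OF assms, symmetric])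
qed

lemma primitive_on_cong:
  assumes "primitive_on a b F f" "\<And>x. x \<in> {a..b} \<Longrightarrow> F x = G x" "\<And>x. x \<in> {a..b} \<Longrightarrow> f x = g x"
  shows "primitive_on a b G g"
  unfolding primitive_on_def
proof (intro conjI ballI)
  show "g absolutely_integrable_on {a..b}"
    using primitive_on_absolutely_integrable[OF assms(1)]
      set_integrable_cong[of lebesgue lebesgue "{a..b}" "{a..b}" f g] assms(3) by auto
  fix x assume x: "x \<in> {a..b}"
  then have "integral {a..x} f = integral {a..x} g"
    using assms(3) by (intro Henstock_Kurzweil_Integration.integral_cong) auto
  then show "G x = G a + integral {a..x} g"
    using primitive_on_eq[OF assms(1) x] assms(2)[OF x] assms(2)[of a] x by simp
qed

lemma primitive_on_bounded_linear:
  fixes T :: "'a::euclidean_space \<Rightarrow> 'b::euclidean_space"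
  assumes "primitive_on a b F f" "bounded_linear T"
  shows "primitive_on a b (\<lambda>x. T (F x)) (\<lambda>x. T (f x))"
  unfolding primitive_on_def
proof (intro conjI ballI)
  show "(\<lambda>x. T (f x)) absolutely_integrable_on {a..b}"
    using absolutely_integrable_linear[OF primitive_on_absolutely_integrable[OF assms(1)] assms(2)]
    by (simp add: o_def)
  fix x assume x: "x \<in> {a..b}"
  have "f integrable_on {a..x}"
    using primitive_on_subinterval_integrable[OF assms(1), of a x] x
    by (simp add: absolutely_integrable_on_def)
  from integral_linear[OF this assms(2)]
  have "integral {a..x} (\<lambda>x. T (f x)) = T (integral {a..x} f)" by (simp add: o_def)
  moreover have "T (F x) = T (F a) + T (integral {a..x} f)"
    unfolding primitive_on_eq[OF assms(1) x] by (rule linear_add[OF bounded_linear.linear[OF assms(2)]])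
  ultimately show "T (F x) = T (F a) + integral {a..x} (\<lambda>x. T (f x))" by simp
qed

text \<open>Reduces a product or chain rule to a first-order estimate on short intervals, with no
  pointwise differentiation of densities that are merely integrable. The tolerated error is
  \<open>e\<close> times the increment of one fixed \<open>M\<close>; \<open>F\<close> minus the
  integral of \<open>f\<close> is then constant by
  \<open>eq_endpoints_if_locally_small\<close>.\<close>

lemma primitive_onI_locally:
  fixes F :: "real \<Rightarrow> 'a::euclidean_space"
  assumes f: "f absolutely_integrable_on {a..b}"
    and small: "\<And>e. e > 0 \<Longrightarrow> \<exists>d>0. \<forall>x\<in>{a..b}. \<forall>y\<in>{a..b}. x \<le> y \<longrightarrow> y - x < d \<longrightarrow>
                  norm (F y - F x - integral {x..y} f) \<le> e * (M y - M x)"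
  shows "primitive_on a b F f"
  unfolding primitive_on_def
proof (intro conjI ballI f)
  fix z assume z: "z \<in> {a..b}"
  define H where "H x = F x - integral {a..x} f" for x
  have "H z = H a"
  proof (rule eq_endpoints_if_locally_small)
    show "a \<le> z" using z by simp
    fix e :: real assume "e > 0"
    from small[OF this] obtain d where "d > 0" and
      d: "\<forall>x\<in>{a..b}. \<forall>y\<in>{a..b}. x \<le> y \<longrightarrow> y - x < d \<longrightarrow>
             norm (F y - F x - integral {x..y} f) \<le> e * (M y - M x)" by blast
    have "H y - H x = F y - F x - integral {x..y} f"
      if "x \<in> {a..b}" "y \<in> {a..b}" "x \<le> y" for x y
    proof -
      have "f integrable_on {a..y}"
        using absolutely_integrable_subinterval_real[of a b f a y] f that
        by (auto simp: absolutely_integrable_on_def)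
      then have "integral {a..x} f + integral {x..y} f = integral {a..y} f"
        using that by (intro Henstock_Kurzweil_Integration.integral_combine) auto
      then show ?thesis by (auto simp: H_def algebra_simps)
    qed
    then show "\<exists>d>0. \<forall>x\<in>{a..z}. \<forall>y\<in>{a..z}. x \<le> y \<longrightarrow> y - x < d \<longrightarrow>
                norm (H y - H x) \<le> e * (M y - M x)"
      using d z \<open>d > 0\<close> by (intro exI[of _ d]) auto
  qed
  then show "F z = F a + integral {a..z} f" by (simp add: H_def algebra_simps)
qed

section \<open>Product and exponential rules for indefinite integrals\<close>

lemma continuous_product_absolutely_integrable:
  fixes h :: "'a::euclidean_space \<Rightarrow> 'b::euclidean_space \<Rightarrow> 'c::euclidean_space"
  assumes h: "bounded_bilinear h"
    and F: "continuous_on {a..b::real} F" and g: "g absolutely_integrable_on {a..b}"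
  shows "(\<lambda>x. h (F x) (g x)) absolutely_integrable_on {a..b}"
proof -
  have 1: "bilinear h" using h by (simp add: bilinear_conv_bounded_bilinear)
  have 2: "F \<in> borel_measurable (lebesgue_on {a..b})"
    using F by (intro continuous_imp_measurable_on_sets_lebesgue) auto
  have 3: "bounded (F ` {a..b})"
    using F by (intro compact_imp_bounded compact_continuous_image) auto
  have 4: "{a..b} \<in> sets lebesgue" by simp
  show ?thesis
    by (rule absolutely_integrable_bounded_measurable_product[OF 1 2 4 3 g])
qed

lemma primitive_on_product:
  fixes h :: "'a::euclidean_space \<Rightarrow> 'b::euclidean_space \<Rightarrow> 'c::euclidean_space"
  assumes h: "bounded_bilinear h" and F: "primitive_on a b F f" and G: "primitive_on a b G g"
  shows "primitive_on a b (\<lambda>x. h (F x) (G x)) (\<lambda>x. h (F x) (g x) + h (f x) (G x))"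
proof -
  interpret h: bounded_bilinear h by (rule h)
  have cF: "continuous_on {a..b} F" and cG: "continuous_on {a..b} G"
    using F G by (blast intro: primitive_on_continuous)+
  have f: "f absolutely_integrable_on {a..b}" and g: "g absolutely_integrable_on {a..b}"
    using F G by (blast intro: primitive_on_absolutely_integrable)+
  have i1: "(\<lambda>x. h (F x) (g x)) absolutely_integrable_on {a..b}"
    by (rule continuous_product_absolutely_integrable[OF h cF g])
  have i2: "(\<lambda>x. h (f x) (G x)) absolutely_integrable_on {a..b}"
    using continuous_product_absolutely_integrable[OF h.flip cG f] .
  define m where "m t = norm (f t) + norm (g t)" for t
  have m: "m integrable_on {a..b}"
    unfolding m_def using f g by (intro Henstock_Kurzweil_Integration.integrable_add) (auto simp: absolutely_integrable_on_def)
  obtain K where "K > 0" and K: "\<And>x y. norm (h x y) \<le> norm x * norm y * K"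
    using h.pos_bounded by blast
  show ?thesis
  proof (rule primitive_onI_locally[where M = "\<lambda>x. integral {a..x} m"])
    show "(\<lambda>x. h (F x) (g x) + h (f x) (G x)) absolutely_integrable_on {a..b}"
      using i1 i2 by (rule set_integral_add(1))
    fix e :: real assume "e > 0"
    then have "e / K > 0" using \<open>K > 0\<close> by simp
    have uF: "uniformly_continuous_on {a..b} F" and uG: "uniformly_continuous_on {a..b} G"
      using cF cG by (simp_all add: compact_uniformly_continuous)
    obtain d1 where "d1 > 0"
      and d1: "\<And>x y. \<lbrakk>x \<in> {a..b}; y \<in> {a..b}; dist y x < d1\<rbrakk> \<Longrightarrow> dist (F y) (F x) < e / K"
      using uF[unfolded uniformly_continuous_on_def, rule_format, OF \<open>e / K > 0\<close>] by blast
    obtain d2 where "d2 > 0"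
      and d2: "\<And>x y. \<lbrakk>x \<in> {a..b}; y \<in> {a..b}; dist y x < d2\<rbrakk> \<Longrightarrow> dist (G y) (G x) < e / K"
      using uG[unfolded uniformly_continuous_on_def, rule_format, OF \<open>e / K > 0\<close>] by blast
    show "\<exists>d>0. \<forall>x\<in>{a..b}. \<forall>y\<in>{a..b}. x \<le> y \<longrightarrow> y - x < d \<longrightarrow>
        norm (h (F y) (G y) - h (F x) (G x) - integral {x..y} (\<lambda>x. h (F x) (g x) + h (f x) (G x)))
          \<le> e * (integral {a..y} m - integral {a..x} m)"
    proof (intro exI[of _ "min d1 d2"] conjI ballI impI)
      fix x y assume xy: "x \<in> {a..b}" "y \<in> {a..b}" "x \<le> y" "y - x < min d1 d2"
      have sub: "u absolutely_integrable_on {x..y}" if "u absolutely_integrable_on {a..b}"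
        for u :: "real \<Rightarrow> 'd::euclidean_space"
        using absolutely_integrable_subinterval_real[OF that] xy by auto
      have fi: "f integrable_on {x..y}" and gi: "g integrable_on {x..y}"
        and i1': "(\<lambda>x. h (F x) (g x)) integrable_on {x..y}"
        and i2': "(\<lambda>x. h (f x) (G x)) integrable_on {x..y}"
        using sub[OF f] sub[OF g] sub[OF i1] sub[OF i2] by (auto simp: absolutely_integrable_on_def)
      have mi: "m integrable_on {x..y}" "m integrable_on {a..y}"
        using integrable_subinterval_real[OF m] xy by auto
      have e1: "((\<lambda>t. h (F y) (g t)) has_integral h (F y) (G y - G x)) {x..y}"
        using has_integral_linear[OF integrable_integral[OF gi] h.bounded_linear_right[of "F y"]]
          primitive_on_diff[OF G, of x y] xy by (simp add: o_def)
      have e2: "((\<lambda>t. h (f t) (G x)) has_integral h (F y - F x) (G x)) {x..y}"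
        using has_integral_linear[OF integrable_integral[OF fi] h.bounded_linear_left[of "G x"]]
          primitive_on_diff[OF F, of x y] xy by (simp add: o_def)
      have "((\<lambda>t. (h (F y) (g t) + h (f t) (G x)) - (h (F t) (g t) + h (f t) (G t))) has_integral
          h (F y) (G y - G x) + h (F y - F x) (G x) - integral {x..y} (\<lambda>t. h (F t) (g t) + h (f t) (G t))) {x..y}"
        by (intro has_integral_diff has_integral_add e1 e2 integrable_integral
             Henstock_Kurzweil_Integration.integrable_add i1' i2')
      moreover have "(\<lambda>t. (h (F y) (g t) + h (f t) (G x)) - (h (F t) (g t) + h (f t) (G t)))
          = (\<lambda>t. h (F y - F t) (g t) + h (f t) (G x - G t))"
        by (auto simp: h.diff_left h.diff_right)
      moreover have "h (F y) (G y - G x) + h (F y - F x) (G x) = h (F y) (G y) - h (F x) (G x)"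
        by (auto simp: h.diff_left h.diff_right)
      ultimately have hi: "((\<lambda>t. h (F y - F t) (g t) + h (f t) (G x - G t)) has_integral
          h (F y) (G y) - h (F x) (G x) - integral {x..y} (\<lambda>t. h (F t) (g t) + h (f t) (G t))) {x..y}"
        by simp
      have "norm (h (F y) (G y) - h (F x) (G x) - integral {x..y} (\<lambda>t. h (F t) (g t) + h (f t) (G t)))
          \<le> integral {x..y} (\<lambda>t. e * m t)"
        unfolding integral_unique[OF hi, symmetric]
      proof (rule Henstock_Kurzweil_Integration.integral_norm_bound_integral)
        show "(\<lambda>t. h (F y - F t) (g t) + h (f t) (G x - G t)) integrable_on {x..y}"
          using hi by blast
        show "(\<lambda>t. e * m t) integrable_on {x..y}"
          using integrable_on_mult_right[OF mi(1)] by simp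
        fix t assume t: "t \<in> {x..y}"
        have "norm (F y - F t) \<le> e / K" "norm (G x - G t) \<le> e / K"
          using d1[of t y] d2[of t x] t xy by (auto simp: dist_norm norm_minus_commute)
        then have le: "norm (F y - F t) * norm (g t) * K \<le> e / K * norm (g t) * K"
          "norm (f t) * norm (G x - G t) * K \<le> norm (f t) * (e / K) * K"
          using \<open>K > 0\<close> by (intro mult_right_mono mult_left_mono; simp)+
        have "norm (h (F y - F t) (g t)) \<le> e / K * norm (g t) * K"
          "norm (h (f t) (G x - G t)) \<le> norm (f t) * (e / K) * K"
          using K[of "F y - F t" "g t"] K[of "f t" "G x - G t"] le by linarith+
        moreover have "e / K * norm (g t) * K = e * norm (g t)" "norm (f t) * (e / K) * K = e * norm (f t)"
          using \<open>K > 0\<close> by auto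
        ultimately show "norm (h (F y - F t) (g t) + h (f t) (G x - G t)) \<le> e * m t"
          using norm_triangle_ineq[of "h (F y - F t) (g t)" "h (f t) (G x - G t)"]
          by (simp add: m_def distrib_left)
      qed
      also have "\<dots> = e * (integral {a..y} m - integral {a..x} m)"
        using Henstock_Kurzweil_Integration.integral_combine[OF _ _ mi(2), of x] xy by simp
      finally show "norm (h (F y) (G y) - h (F x) (G x) - integral {x..y} (\<lambda>x. h (F x) (g x) + h (f x) (G x)))
          \<le> e * (integral {a..y} m - integral {a..x} m)" .
    qed (use \<open>d1 > 0\<close> \<open>d2 > 0\<close> in auto)
  qed
qed

text \<open>Factor the increment as \<open>exp (F x) * (exp (F y - F x) - 1)\<close> and linearise
  \<open>exp\<close> at 0. The remainder is small relative to \<open>norm (F y - F x)\<close>, which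
  the integral of \<open>norm (f t)\<close> bounds; freezing \<open>exp (F t)\<close> at
  \<open>t = x\<close> costs only an oscillation.\<close>

lemma primitive_on_exp:
  fixes F :: "real \<Rightarrow> complex"
  assumes F: "primitive_on a b F f"
  shows "primitive_on a b (\<lambda>x. exp (F x)) (\<lambda>x. exp (F x) * f x)"
proof -
  have cF: "continuous_on {a..b} F"
    using F by (rule primitive_on_continuous)
  have cE: "continuous_on {a..b} (\<lambda>x. exp (F x))"
    using cF by (intro continuous_intros)
  have f: "f absolutely_integrable_on {a..b}"
    using F by (rule primitive_on_absolutely_integrable)
  have i1: "(\<lambda>x. exp (F x) * f x) absolutely_integrable_on {a..b}"
    by (rule continuous_product_absolutely_integrable[OF bounded_bilinear_mult cE f])
  define m where "m t = norm (f t)" for t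
  have m: "m integrable_on {a..b}"
    unfolding m_def using f by (auto simp: absolutely_integrable_on_def)
  have "bounded ((\<lambda>x. exp (F x)) ` {a..b})"
    using cE by (intro compact_imp_bounded compact_continuous_image) auto
  then obtain B where "B > 0" and B: "\<And>x. x \<in> {a..b} \<Longrightarrow> norm (exp (F x)) \<le> B"
    unfolding bounded_pos by auto
  show ?thesis
  proof (rule primitive_onI_locally[where M = "\<lambda>x. integral {a..x} m", OF i1])
    fix e :: real assume "e > 0"
    \<comment> \<open>The two errors get half of \<open>e\<close> each; the remainder of
      \<open>exp\<close> is still multiplied by \<open>norm (exp (F x)) \<le> B\<close>, hence the
      extra factor \<open>B\<close>.\<close>
    then have e: "e / (2 * B) > 0" "e / 2 > 0" using \<open>B > 0\<close> by auto
    have "(exp has_derivative (*) 1) (at (0::complex))"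
      using DERIV_exp[of "0::complex"] by (simp add: has_field_derivative_def)
    then have "\<exists>r>0. \<forall>z::complex. norm (z - 0) < r \<longrightarrow>
        norm (exp z - exp 0 - 1 * (z - 0)) \<le> e / (2 * B) * norm (z - 0)"
      unfolding has_derivative_at_alt using e(1) by blast
    then obtain r where "r > 0" and
      r: "\<And>z::complex. norm z < r \<Longrightarrow> norm (exp z - 1 - z) \<le> e / (2 * B) * norm z"
      by auto
    have uF: "uniformly_continuous_on {a..b} F"
      and uE: "uniformly_continuous_on {a..b} (\<lambda>x. exp (F x))"
      using cF cE by (simp_all add: compact_uniformly_continuous)
    obtain d1 where "d1 > 0"
      and d1: "\<And>x y. \<lbrakk>x \<in> {a..b}; y \<in> {a..b}; dist y x < d1\<rbrakk> \<Longrightarrow> dist (F y) (F x) < r"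
      using uF[unfolded uniformly_continuous_on_def, rule_format, OF \<open>r > 0\<close>] by blast
    obtain d2 where "d2 > 0"
      and d2: "\<And>x y. \<lbrakk>x \<in> {a..b}; y \<in> {a..b}; dist y x < d2\<rbrakk> \<Longrightarrow> dist (exp (F y)) (exp (F x)) < e / 2"
      using uE[unfolded uniformly_continuous_on_def, rule_format, OF e(2)] by blast
    show "\<exists>d>0. \<forall>x\<in>{a..b}. \<forall>y\<in>{a..b}. x \<le> y \<longrightarrow> y - x < d \<longrightarrow>
        norm (exp (F y) - exp (F x) - integral {x..y} (\<lambda>x. exp (F x) * f x))
          \<le> e * (integral {a..y} m - integral {a..x} m)"
    proof (intro exI[of _ "min d1 d2"] conjI ballI impI)
      fix x y assume xy: "x \<in> {a..b}" "y \<in> {a..b}" "x \<le> y" "y - x < min d1 d2"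
      have fi: "f integrable_on {x..y}" and i1': "(\<lambda>x. exp (F x) * f x) integrable_on {x..y}"
        using absolutely_integrable_subinterval_real[OF f] absolutely_integrable_subinterval_real[OF i1] xy
        by (auto simp: absolutely_integrable_on_def)
      have mi: "m integrable_on {x..y}" "m integrable_on {a..y}"
        using integrable_subinterval_real[OF m] xy by auto
      have e1: "((\<lambda>t. exp (F x) * f t) has_integral exp (F x) * (F y - F x)) {x..y}"
        using has_integral_mult_right[OF integrable_integral[OF fi], of "exp (F x)"]
          primitive_on_diff[OF F, of x y] xy by simp
      have hi: "((\<lambda>t. (exp (F x) - exp (F t)) * f t) has_integral
          exp (F x) * (F y - F x) - integral {x..y} (\<lambda>t. exp (F t) * f t)) {x..y}"
        using has_integral_diff[OF e1 integrable_integral[OF i1']] by (simp add: left_diff_distrib)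
      have "norm (exp (F x) * (F y - F x) - integral {x..y} (\<lambda>t. exp (F t) * f t))
          \<le> integral {x..y} (\<lambda>t. e / 2 * m t)"
        unfolding integral_unique[OF hi, symmetric]
      proof (rule Henstock_Kurzweil_Integration.integral_norm_bound_integral)
        show "(\<lambda>t. (exp (F x) - exp (F t)) * f t) integrable_on {x..y}"
          using hi by blast
        show "(\<lambda>t. e / 2 * m t) integrable_on {x..y}"
          using integrable_on_mult_right[OF mi(1), of "e / 2"] by simp
        fix t assume t: "t \<in> {x..y}"
        have "norm (exp (F x) - exp (F t)) \<le> e / 2"
          using d2[of t x] t xy by (auto simp: dist_norm)
        then show "norm ((exp (F x) - exp (F t)) * f t) \<le> e / 2 * m t"
          unfolding m_def norm_mult by (intro mult_right_mono) auto
      qed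
      also have "\<dots> = e / 2 * (integral {a..y} m - integral {a..x} m)"
        using Henstock_Kurzweil_Integration.integral_combine[OF _ _ mi(2), of x] xy by simp
      finally have A: "norm (exp (F x) * (F y - F x) - integral {x..y} (\<lambda>t. exp (F t) * f t))
        \<le> e / 2 * (integral {a..y} m - integral {a..x} m)" .
      have meq: "(\<lambda>t. norm (f t)) = m" by (simp add: m_def fun_eq_iff)
      have nF: "norm (F y - F x) \<le> integral {a..y} m - integral {a..x} m"
        using primitive_on_norm_diff[OF F, of x y] xy
          Henstock_Kurzweil_Integration.integral_combine[OF _ _ mi(2), of x]
        by (simp add: meq)
      have "norm (F y - F x) < r"
        using d1[of x y] xy by (auto simp: dist_norm)
      from r[OF this] have "norm (exp (F y - F x) - 1 - (F y - F x)) \<le> e / (2 * B) * norm (F y - F x)" .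
      then have "norm (exp (F x)) * norm (exp (F y - F x) - 1 - (F y - F x)) \<le> B * (e / (2 * B) * norm (F y - F x))"
        using B[OF xy(1)] \<open>B > 0\<close> by (intro mult_mono) auto
      also have "\<dots> = e / 2 * norm (F y - F x)" using \<open>B > 0\<close> by simp
      also have "\<dots> \<le> e / 2 * (integral {a..y} m - integral {a..x} m)"
        using nF \<open>e > 0\<close> by (intro mult_left_mono) auto
      finally have Bd: "norm (exp (F x) * (exp (F y - F x) - 1 - (F y - F x)))
         \<le> e / 2 * (integral {a..y} m - integral {a..x} m)" by (simp add: norm_mult)
      have "exp (F x) * (exp (F y - F x) - 1 - (F y - F x)) = exp (F y) - exp (F x) - exp (F x) * (F y - F x)"
        by (simp add: exp_diff algebra_simps)
      with A Bd show "norm (exp (F y) - exp (F x) - integral {x..y} (\<lambda>x. exp (F x) * f x))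
          \<le> e * (integral {a..y} m - integral {a..x} m)"
        using norm_triangle_ineq[of "exp (F y) - exp (F x) - exp (F x) * (F y - F x)"
          "exp (F x) * (F y - F x) - integral {x..y} (\<lambda>t. exp (F t) * f t)"]
        by (simp add: field_simps)
    qed (use \<open>d1 > 0\<close> \<open>d2 > 0\<close> in auto)
  qed
qed

section \<open>Test functions\<close>

text \<open>The flat function \<open>exp (- (1 / x))\<close>, extended by 0. The polynomial in
  \<open>1 / x\<close> is carried along because differentiation produces powers of
  \<open>1 / x\<close>; with it the family is closed under derivatives.\<close>

definition exp_inv :: "real poly \<Rightarrow> real \<Rightarrow> real" where
  "exp_inv p x = (if x > 0 then poly p (1 / x) * exp (- (1 / x)) else 0)"

lemma poly_times_exp_minus_tendsto_0:
  fixes p :: "real poly"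
  shows "((\<lambda>x. poly p x * exp (- x)) \<longlongrightarrow> 0) at_top"
proof -
  have "((\<lambda>x. \<Sum>i\<le>degree p. coeff p i * (x ^ i / exp x)) \<longlongrightarrow> (\<Sum>i\<le>degree p. coeff p i * 0)) at_top"
    by (intro tendsto_intros tendsto_power_div_exp_0)
  then show ?thesis
    by (simp add: poly_altdef exp_minus sum_distrib_right divide_inverse mult.assoc)
qed

lemma exp_inv_tendsto_0: "(exp_inv p \<longlongrightarrow> 0) (at 0)"
proof -
  have "((\<lambda>x. poly p (inverse x) * exp (- inverse x)) \<longlongrightarrow> 0) (at_right 0)"
    using filterlim_compose[OF poly_times_exp_minus_tendsto_0 filterlim_inverse_at_top_right] .
  moreover have "\<forall>\<^sub>F x in at_right 0. poly p (inverse x) * exp (- inverse x) = exp_inv p x"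
    using eventually_at_right_less[of 0] by eventually_elim (simp add: exp_inv_def inverse_eq_divide)
  ultimately have "(exp_inv p \<longlongrightarrow> 0) (at_right 0)"
    by (rule Lim_transform_eventually)
  moreover have "(exp_inv p \<longlongrightarrow> 0) (at_left 0)"
  proof (rule tendsto_eventually)
    show "\<forall>\<^sub>F x in at_left 0. exp_inv p x = 0"
      unfolding eventually_at_left_field by (intro exI[of _ "-1"]) (auto simp: exp_inv_def)
  qed
  ultimately show ?thesis
    by (simp add: filterlim_split_at)
qed

text \<open>For \<open>x > 0\<close> put \<open>u = 1 / x\<close>: since the derivative of
  \<open>u\<close> is \<open>- (u^2)\<close>, the polynomial \<open>p\<close> turns into
  \<open>u^2 (p - p')\<close>. At 0 the difference quotient is again a member of the family, with
  polynomial \<open>[:0, 1:] * p\<close>, and members tend to 0 there.\<close>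

lemma exp_inv_has_derivative:
  "(exp_inv p has_real_derivative exp_inv ([:0, 0, 1:] * (p - pderiv p)) x) (at x)"
proof -
  consider "x > 0" | "x < 0" | "x = 0" by linarith
  then show ?thesis
  proof cases
    case 1
    have "((\<lambda>x. poly p (1 / x) * exp (- (1 / x))) has_real_derivative
        exp_inv ([:0, 0, 1:] * (p - pderiv p)) x) (at x)"
      using 1 by (auto intro!: derivative_eq_intros DERIV_chain'[OF _ poly_DERIV]
          simp: exp_inv_def field_simps power2_eq_square)
    then show ?thesis
      by (rule has_field_derivative_transform_within[where d = x])
        (use 1 in \<open>auto simp: exp_inv_def dist_real_def\<close>)
  next
    case 2
    have "((\<lambda>x. 0) has_real_derivative 0) (at x)" by simp
    then have "(exp_inv p has_real_derivative 0) (at x)"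
      by (rule has_field_derivative_transform_within[where d = "- x"])
        (use 2 in \<open>auto simp: exp_inv_def dist_real_def\<close>)
    then show ?thesis using 2 by (simp add: exp_inv_def)
  next
    case 3
    have "exp_inv ([:0, 1:] * p) h = exp_inv p h / h" for h
      by (auto simp: exp_inv_def)
    then have "exp_inv ([:0, 1:] * p) = (\<lambda>h. exp_inv p h / h)" by (rule ext)
    then have "((\<lambda>h. exp_inv p h / h) \<longlongrightarrow> 0) (at 0)"
      using exp_inv_tendsto_0[of "[:0, 1:] * p"] by simp
    then show ?thesis
      unfolding 3 by (simp add: DERIV_def exp_inv_def[of _ 0])
  qed
qed

text \<open>Every member has a derivative in the class, which gives smoothness without a formula for the
  higher derivatives.\<close>

inductive smooth_gen :: "(real \<Rightarrow> real) \<Rightarrow> bool" where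
  exp_inv: "smooth_gen (\<lambda>x. exp_inv p (c * x + d))"
| scale: "smooth_gen f \<Longrightarrow> smooth_gen (\<lambda>x. c * f x)"
| add: "smooth_gen f \<Longrightarrow> smooth_gen g \<Longrightarrow> smooth_gen (\<lambda>x. f x + g x)"
| mult: "smooth_gen f \<Longrightarrow> smooth_gen g \<Longrightarrow> smooth_gen (\<lambda>x. f x * g x)"

lemma smooth_gen_has_derivative:
  assumes "smooth_gen f"
  shows "\<exists>g. smooth_gen g \<and> (\<forall>x. (f has_real_derivative g x) (at x))"
  using assms
proof induction
  case (exp_inv p c d)
  let ?g = "\<lambda>x. c * exp_inv ([:0, 0, 1:] * (p - pderiv p)) (c * x + d)"
  have "((\<lambda>x. exp_inv p (c * x + d)) has_real_derivative ?g x) (at x)" for x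
  proof -
    have "((\<lambda>x. c * x + d) has_real_derivative c) (at x)"
      by (auto intro!: derivative_eq_intros)
    from DERIV_chain2[OF exp_inv_has_derivative this] show ?thesis
      unfolding mult.commute[of c "exp_inv _ _"] .
  qed
  then show ?case
    by (intro exI[of _ ?g] conjI smooth_gen.scale smooth_gen.exp_inv) auto
next
  case (scale f c)
  then obtain g where "smooth_gen g" "\<And>x. (f has_real_derivative g x) (at x)" by blast
  then show ?case
    by (intro exI[of _ "\<lambda>x. c * g x"] conjI smooth_gen.scale allI DERIV_cmult) auto
next
  case (add f1 f2)
  then obtain g1 g2 where "smooth_gen g1" "\<And>x. (f1 has_real_derivative g1 x) (at x)"
     "smooth_gen g2" "\<And>x. (f2 has_real_derivative g2 x) (at x)" by blast
  then show ?case
    by (intro exI[of _ "\<lambda>x. g1 x + g2 x"] conjI smooth_gen.add allI DERIV_add) auto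
next
  case (mult f1 f2)
  then obtain g1 g2 where g: "smooth_gen g1" "\<And>x. (f1 has_real_derivative g1 x) (at x)"
     "smooth_gen g2" "\<And>x. (f2 has_real_derivative g2 x) (at x)" by blast
  have "smooth_gen (\<lambda>x. g1 x * f2 x + g2 x * f1 x)"
    using g mult.hyps by (intro smooth_gen.add smooth_gen.mult) auto
  moreover have "((\<lambda>x. f1 x * f2 x) has_real_derivative g1 x * f2 x + g2 x * f1 x) (at x)" for x
    using g by (intro DERIV_mult) auto
  ultimately show ?case by blast
qed

lemma smooth_gen_deriv: "smooth_gen f \<Longrightarrow> smooth_gen (deriv f)"
  by (metis DERIV_imp_deriv ext smooth_gen_has_derivative)

lemma smooth_gen_deriv_funpow: "smooth_gen f \<Longrightarrow> smooth_gen ((deriv ^^ n) f)"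
  by (induction n) (auto intro: smooth_gen_deriv)

lemma smooth_gen_isCont: "smooth_gen f \<Longrightarrow> isCont f x"
  using smooth_gen_has_derivative DERIV_isCont by blast

lemma smooth_gen_continuous_on: "smooth_gen f \<Longrightarrow> continuous_on S f"
  by (simp add: continuous_at_imp_continuous_on smooth_gen_isCont)

lemma smooth_gen_differentiable_on: "smooth_gen f \<Longrightarrow> f differentiable_on S"
  unfolding differentiable_on_def
  by (metis differentiable_at_withinI real_differentiable_def smooth_gen_has_derivative)

lemma closure_support_subset:
  fixes f :: "real \<Rightarrow> real"
  assumes "0 < a" "b < 2 * pi" "\<And>x. x < a \<or> b < x \<Longrightarrow> f x = 0"
  shows "closure {x. f x \<noteq> 0} \<subseteq> {0<..<2 * pi}"
proof -
  have "closure {x. f x \<noteq> 0} \<subseteq> {a..b}"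
    using assms(3) by (intro closure_minimal) (auto simp: not_less[symmetric])
  then show ?thesis using assms by force
qed

lemma smooth_gen_test_function:
  assumes "smooth_gen f" "0 < a" "b < 2 * pi" "\<And>x. x < a \<or> b < x \<Longrightarrow> f x = 0"
  shows "f \<in> test_functions"
  unfolding test_functions_def
  using assms closure_support_subset[OF assms(2-4)]
  by (auto intro: smooth_gen_differentiable_on smooth_gen_deriv_funpow)

text \<open>The vanishing integral brings the antiderivative back to 0 to the right of the support.
  This yields the mean-zero functions that occur as derivatives of test functions in the du
  Bois-Reymond argument. Higher derivatives of \<open>\<phi>\<close> are derivatives of
  \<open>f\<close>, so \<open>\<phi>\<close> itself need not be of the form
  \<open>smooth_gen\<close>.\<close>

lemma antiderivative_test_function:
  assumes f: "smooth_gen f" and ab: "0 < a" "b < 2 * pi" "\<And>x. x < a \<or> b < x \<Longrightarrow> f x = 0"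
    and int: "integral per_interval f = 0"
  obtains \<phi> where "\<phi> \<in> test_functions" "deriv \<phi> = f"
proof -
  obtain F where F: "\<And>x. (F has_vector_derivative f x) (at x)"
    using einterval_antiderivative[of "-\<infinity>" "\<infinity>" f] smooth_gen_isCont[OF f] by auto
  define \<phi> where "\<phi> x = F x - F 0" for x
  have D: "(\<phi> has_real_derivative f x) (at x)" for x
    unfolding \<phi>_def using F[of x]
    by (auto simp: has_real_derivative_iff_has_vector_derivative intro!: derivative_eq_intros)
  have deriv: "deriv \<phi> = f"
    using D DERIV_imp_deriv by blast
  have ftc: "\<phi> y - \<phi> x = integral {x..y} f" if "x \<le> y" for x y
    using that D
    by (intro integral_unique[symmetric] fundamental_theorem_of_calculus)
       (auto simp: has_real_derivative_iff_has_vector_derivative[symmetric] intro: has_field_derivative_at_within)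
  have z0: "\<phi> 0 = 0" by (simp add: \<phi>_def)
  have z1: "\<phi> (2 * pi) = 0" using ftc[of 0 "2 * pi"] int z0 by simp
  have out: "\<phi> x = 0" if "x < a \<or> b < x" for x
  proof (cases "x < a")
    case True
    \<comment> \<open>\<open>x\<close> may lie on either side of 0, hence \<open>min\<close> and
      \<open>max\<close>; in both cases the interval stays to the left of \<open>a\<close>.\<close>
    have "integral {min x 0..max x 0} f = 0"
      using True ab by (intro integral_unique has_integral_is_0) (auto simp: max_def split: if_splits)
    then show ?thesis
      using ftc[of "min x 0" "max x 0"] z0 by (auto simp: min_def max_def split: if_splits)
  next
    case False
    then have "b < x" using that by auto
    have "integral {min x (2 * pi)..max x (2 * pi)} f = 0"
      using ab \<open>b < x\<close> by (intro integral_unique has_integral_is_0) (auto simp: min_def split: if_splits)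
    then show ?thesis
      using ftc[of "min x (2 * pi)" "max x (2 * pi)"] z1 by (auto simp: min_def max_def split: if_splits)
  qed
  have "(deriv ^^ n) \<phi> differentiable_on UNIV" for n
  proof (cases n)
    case 0
    then show ?thesis
      using D by (auto simp: differentiable_on_def real_differentiable_def)
  next
    case (Suc m)
    have "(deriv ^^ n) \<phi> = (deriv ^^ m) f"
      unfolding Suc funpow_Suc_right o_def deriv ..
    then show ?thesis
      using f by (auto intro: smooth_gen_differentiable_on smooth_gen_deriv_funpow)
  qed
  then have "\<phi> \<in> test_functions"
    unfolding test_functions_def using closure_support_subset[OF ab(1,2) out] by auto
  then show ?thesis using that deriv by blast
qed

text \<open>\<open>c\<close> is a sharpness parameter: for \<open>c > 0\<close> the function lives
  on \<open>{a<..<b}\<close>, and as \<open>c\<close> tends to infinity its values there increase to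
  1.\<close>

definition bump :: "real \<Rightarrow> real \<Rightarrow> real \<Rightarrow> real \<Rightarrow> real" where
  "bump a b c x = exp_inv 1 (c * (x - a)) * exp_inv 1 (c * (b - x))"

lemma smooth_gen_bump: "smooth_gen (bump a b c)"
proof -
  have "smooth_gen (\<lambda>x. exp_inv 1 (c * x + (- c * a)) * exp_inv 1 ((- c) * x + c * b))"
    by (intro smooth_gen.mult smooth_gen.exp_inv)
  then show ?thesis
    unfolding bump_def[abs_def] by (simp add: algebra_simps)
qed

lemma bump_outside: "c > 0 \<Longrightarrow> x \<notin> {a<..<b} \<Longrightarrow> bump a b c x = 0"
  by (auto simp: bump_def exp_inv_def zero_less_mult_iff)

lemma bump_pos: "c > 0 \<Longrightarrow> x \<in> {a<..<b} \<Longrightarrow> bump a b c x > 0"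
  by (auto simp: bump_def exp_inv_def zero_less_mult_iff)

lemma exp_inv_1_bounds: "0 \<le> exp_inv 1 x" "exp_inv 1 x \<le> 1"
  by (auto simp: exp_inv_def)

lemma bump_bounds: "0 \<le> bump a b c x" "bump a b c x \<le> 1"
  using exp_inv_1_bounds by (auto simp: bump_def intro: mult_le_one)

lemma bump_tendsto_indicator:
  "(\<lambda>n. bump a b (real (Suc n)) x) \<longlonglongrightarrow> indicator {a<..<b} x"
proof (cases "x \<in> {a<..<b}")
  case True
  have *: "(\<lambda>n. exp_inv 1 (real (Suc n) * t)) \<longlonglongrightarrow> 1" if "t > 0" for t
  proof -
    have "(\<lambda>n. exp (- (inverse (real (Suc n)) * (1 / t)))) \<longlonglongrightarrow> exp (- (0 * (1 / t)))"
      by (intro tendsto_intros LIMSEQ_inverse_real_of_nat)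
    moreover have "exp_inv 1 (real (Suc n) * t) = exp (- (inverse (real (Suc n)) * (1 / t)))" for n
      using that mult_pos_pos[of "real (Suc n)" t] by (simp add: exp_inv_def field_simps del: of_nat_Suc)
    ultimately show ?thesis by simp
  qed
  have "(\<lambda>n. bump a b (real (Suc n)) x) \<longlonglongrightarrow> 1 * 1"
    unfolding bump_def using True by (intro tendsto_mult *) auto
  then show ?thesis using True by simp
next
  case False
  then show ?thesis by (simp add: bump_outside del: of_nat_Suc)
qed

lemma bump_test_function:
  "0 < a \<Longrightarrow> b < 2 * pi \<Longrightarrow> c > 0 \<Longrightarrow> bump a b c \<in> test_functions"
  by (rule smooth_gen_test_function[OF smooth_gen_bump, of a b]) (auto intro: bump_outside)

section \<open>Weak derivatives\<close>

lemma per_measure_finite: "finite_measure per_measure"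
  by (rule finite_measure_lebesgue_on) simp

lemma continuous_on_measurable_per [intro]:
  fixes f :: "real \<Rightarrow> 'a::euclidean_space"
  shows "continuous_on per_interval f \<Longrightarrow> f \<in> borel_measurable per_measure"
  by (rule continuous_imp_measurable_on_sets_lebesgue) auto

lemma per_integrable_iff:
  fixes f :: "real \<Rightarrow> 'a::euclidean_space"
  shows "integrable per_measure f \<longleftrightarrow> f absolutely_integrable_on per_interval"
  by (simp add: set_integrable_def integrable_restrict_space)

lemma per_integral_eq:
  fixes f :: "real \<Rightarrow> 'a::euclidean_space"
  shows "integrable per_measure f \<Longrightarrow> (LINT x|per_measure. f x) = integral per_interval f"
  by (rule lebesgue_integral_eq_integral) auto

lemma continuous_on_per_integrable:
  fixes f :: "real \<Rightarrow> 'a::euclidean_space"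
  shows "continuous_on per_interval f \<Longrightarrow> integrable per_measure f"
  unfolding per_integrable_iff by (rule absolutely_integrable_continuous_real)

lemma continuous_on_L2_per:
  fixes f :: "real \<Rightarrow> 'a::euclidean_space"
  assumes "continuous_on per_interval f"
  shows "f \<in> L2_per"
  unfolding L2_per_def using assms
  by (auto intro!: continuous_on_per_integrable continuous_intros)

lemma L2_perD:
  assumes "f \<in> L2_per"
  shows "f \<in> borel_measurable per_measure" "integrable per_measure (\<lambda>x. (norm (f x))\<^sup>2)"
  using assms by (auto simp: L2_per_def)

lemma L2_perI_bound:
  fixes f :: "real \<Rightarrow> 'a::euclidean_space" and g :: "real \<Rightarrow> 'b::euclidean_space"
  assumes "g \<in> L2_per" "f \<in> borel_measurable per_measure"
    and "AE x in per_measure. norm (f x) \<le> C * norm (g x)"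
  shows "f \<in> L2_per"
proof -
  have "integrable per_measure (\<lambda>x. C\<^sup>2 * (norm (g x))\<^sup>2)"
    using L2_perD(2)[OF assms(1)] by simp
  then have "integrable per_measure (\<lambda>x. (norm (f x))\<^sup>2)"
  proof (rule Bochner_Integration.integrable_bound)
    show "AE x in per_measure. norm ((norm (f x))\<^sup>2) \<le> norm (C\<^sup>2 * (norm (g x))\<^sup>2)"
      using assms(3) by eventually_elim (auto simp flip: power_mult_distrib intro: power_mono)
  qed (use assms(2) in measurable)
  then show ?thesis using assms(2) by (simp add: L2_per_def)
qed

lemma L2_per_integrable:
  assumes "f \<in> L2_per"
  shows "integrable per_measure f"
proof (rule Bochner_Integration.integrable_bound)
  show "integrable per_measure (\<lambda>x. 1 + (norm (f x))\<^sup>2)"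
    using L2_perD(2)[OF assms] finite_measure.integrable_const[OF per_measure_finite] by simp
  have "norm (f x) \<le> 1 + (norm (f x))\<^sup>2" for x
    using zero_le_power2[of "norm (f x) - 1"] norm_ge_zero[of "f x"]
    unfolding power2_diff power_one mult_1_right by linarith
  then show "AE x in per_measure. norm (f x) \<le> norm (1 + (norm (f x))\<^sup>2)"
    by simp
qed (rule L2_perD(1)[OF assms])

text \<open>Bridge between the almost-everywhere statements of the Bochner integral and the
  exceptional sets of the gauge integral. Completeness of Lebesgue measure makes it valid for
  arbitrary \<open>P\<close>.\<close>

lemma AE_per_iff_negligible:
  "(AE x in per_measure. P x) \<longleftrightarrow> (\<exists>N. negligible N \<and> (\<forall>x\<in>per_interval - N. P x))"
proof -
  have "(AE x in per_measure. P x) \<longleftrightarrow> (AE x in lebesgue. x \<in> per_interval \<longrightarrow> P x)"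
    by (rule AE_restrict_space_iff) simp
  also have "\<dots> \<longleftrightarrow> negligible {x. \<not> (x \<in> per_interval \<longrightarrow> P x)}"
    by (simp add: AE_iff_null_sets[where M = lebesgue] completion.AE_iff_null_sets negligible_iff_null_sets)
  also have "\<dots> \<longleftrightarrow> (\<exists>N. negligible N \<and> (\<forall>x\<in>per_interval - N. P x))"
    by (metis (no_types, lifting) Diff_iff mem_Collect_eq negligible_subset subsetI)
  finally show ?thesis .
qed

lemma AE_per_in_interval: "AE x in per_measure. x \<in> per_interval"
  using AE_space[of per_measure] by simp

lemma primitive_on_cong_AE:
  assumes F: "primitive_on 0 (2 * pi) F f" and AE: "AE x in per_measure. f x = g x"
    and g: "g \<in> borel_measurable per_measure"
  shows "primitive_on 0 (2 * pi) F g"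
proof -
  obtain N where N: "negligible N" "\<And>x. x \<in> per_interval - N \<Longrightarrow> f x = g x"
    using AE unfolding AE_per_iff_negligible by blast
  have "g absolutely_integrable_on per_interval"
    using absolutely_integrable_spike[OF primitive_on_absolutely_integrable[OF F] N(1)] N(2) by simp
  moreover have "integral {0..x} g = integral {0..x} f" if "x \<in> per_interval" for x
    using that N by (intro integral_spike[of N]) auto
  ultimately show ?thesis
    using F unfolding primitive_on_def by metis
qed

lemma test_function_primitive:
  assumes "\<phi> \<in> test_functions"
  shows "primitive_on 0 (2 * pi) \<phi> (deriv \<phi>)" "\<phi> 0 = 0" "\<phi> (2 * pi) = 0"
    "continuous_on S \<phi>" "continuous_on S (deriv \<phi>)"
proof -
  have d: "(deriv ^^ n) \<phi> differentiable_on UNIV" for n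
    using assms by (auto simp: test_functions_def)
  have s: "closure {x. \<phi> x \<noteq> 0} \<subseteq> {0<..<2 * pi}"
    using assms by (auto simp: test_functions_def)
  have "\<phi> differentiable (at x)" for x
    using d[of 0] by (simp add: differentiable_on_def)
  then have D: "(\<phi> has_real_derivative deriv \<phi> x) (at x)" for x
    by (simp add: DERIV_deriv_iff_real_differentiable)
  have c: "continuous_on UNIV (deriv \<phi>)"
    using differentiable_imp_continuous_on[OF d[of 1]] by simp
  then show cont: "continuous_on S (deriv \<phi>)"
    by (rule continuous_on_subset) simp
  show "continuous_on S \<phi>"
    using differentiable_imp_continuous_on[OF d[of 0]] by (auto intro: continuous_on_subset)
  show "\<phi> 0 = 0" "\<phi> (2 * pi) = 0"
    using s closure_subset[of "{x. \<phi> x \<noteq> 0}"] by force+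
  show "primitive_on 0 (2 * pi) \<phi> (deriv \<phi>)"
    unfolding primitive_on_def
  proof (intro conjI ballI)
    show "deriv \<phi> absolutely_integrable_on per_interval"
      using continuous_on_subset[OF c] by (intro absolutely_integrable_continuous_real) simp
    fix x assume "x \<in> per_interval"
    then have "(deriv \<phi> has_integral \<phi> x - \<phi> 0) {0..x}"
      using D by (intro fundamental_theorem_of_calculus)
        (auto simp: has_real_derivative_iff_has_vector_derivative[symmetric] intro: has_field_derivative_at_within)
    then show "\<phi> x = \<phi> 0 + integral {0..x} (deriv \<phi>)" by (simp add: integral_unique)
  qed
qed

section \<open>From indefinite integrals to weak derivatives and back\<close>

lemma primitive_on_times_test_function:
  fixes F :: "real \<Rightarrow> 'a::euclidean_space"
  assumes F: "primitive_on 0 (2 * pi) F f" and \<phi>: "\<phi> \<in> test_functions"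
  shows "(LINT x|per_measure. deriv \<phi> x *\<^sub>R F x) = - (LINT x|per_measure. \<phi> x *\<^sub>R f x)"
proof -
  note t = test_function_primitive[OF \<phi>]
  have i1: "integrable per_measure (\<lambda>x. \<phi> x *\<^sub>R f x)"
    unfolding per_integrable_iff
    by (rule continuous_product_absolutely_integrable[OF bounded_bilinear_scaleR t(4)
        primitive_on_absolutely_integrable[OF F]])
  have i2: "integrable per_measure (\<lambda>x. deriv \<phi> x *\<^sub>R F x)"
    by (intro continuous_on_per_integrable continuous_intros t primitive_on_continuous[OF F])
  have "0 = \<phi> (2 * pi) *\<^sub>R F (2 * pi) - \<phi> 0 *\<^sub>R F 0"
    using t(2,3) by simp
  also have "\<dots> = integral per_interval (\<lambda>x. \<phi> x *\<^sub>R f x + deriv \<phi> x *\<^sub>R F x)"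
    by (rule primitive_on_diff[OF primitive_on_product[OF bounded_bilinear_scaleR t(1) F]]) auto
  also have "\<dots> = (LINT x|per_measure. \<phi> x *\<^sub>R f x + deriv \<phi> x *\<^sub>R F x)"
    using i1 i2 by (intro per_integral_eq[symmetric]) auto
  also have "\<dots> = (LINT x|per_measure. \<phi> x *\<^sub>R f x) + (LINT x|per_measure. deriv \<phi> x *\<^sub>R F x)"
    using i1 i2 by (rule Bochner_Integration.integral_add)
  finally show ?thesis
    by (metis add.commute add_eq_0_iff)
qed

lemma has_weak_derivD:
  assumes "has_weak_deriv f g"
  shows "f \<in> L2_per" "g \<in> L2_per"
    "\<phi> \<in> test_functions \<Longrightarrow>
      (LINT x|per_measure. \<phi> x *\<^sub>R g x) = - (LINT x|per_measure. deriv \<phi> x *\<^sub>R f x)"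
  using assms by (simp_all add: has_weak_deriv_def)

lemma primitive_on_has_weak_deriv:
  assumes "primitive_on 0 (2 * pi) F f" "f \<in> L2_per"
  shows "has_weak_deriv F f"
  unfolding has_weak_deriv_def
  using assms primitive_on_times_test_function continuous_on_L2_per[OF primitive_on_continuous] by blast

text \<open>The fundamental lemma of the calculus of variations. Sharpening the bumps gives, by
  dominated convergence, vanishing integrals over all intervals in the interior; the Lebesgue
  differentiation theorem then recovers \<open>u\<close> almost everywhere.\<close>

lemma AE_zero_if_orthogonal_to_bumps:
  fixes u :: "real \<Rightarrow> 'a::euclidean_space"
  assumes u: "integrable per_measure u"
    and orth: "\<And>a b c. \<lbrakk>0 < a; a < b; b < 2 * pi; c > 0\<rbrakk> \<Longrightarrow> (LINT x|per_measure. bump a b c x *\<^sub>R u x) = 0"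
  shows "AE x in per_measure. u x = 0"
proof -
  have ui: "u integrable_on per_interval"
    using u by (simp add: per_integrable_iff absolutely_integrable_on_def)
  have zero: "integral {a..b} u = 0" if ab: "0 < a" "a < b" "b < 2 * pi" for a b
  proof -
    have "(\<lambda>n. LINT x|per_measure. bump a b (real (Suc n)) x *\<^sub>R u x)
        \<longlonglongrightarrow> (LINT x|per_measure. indicator {a<..<b} x *\<^sub>R u x)"
    proof (rule integral_dominated_convergence[where w = "\<lambda>x. norm (u x)"])
      have mu: "u \<in> borel_measurable per_measure" using u by auto
      have mb: "bump a b c \<in> borel_measurable per_measure" for c
        using smooth_gen_continuous_on[OF smooth_gen_bump] by blast
      show "(\<lambda>x. bump a b (real (Suc n)) x *\<^sub>R u x) \<in> borel_measurable per_measure" for n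
        by (intro borel_measurable_scaleR mb mu)
      have "indicat_real {a<..<b} \<in> borel_measurable per_measure"
        using bump_tendsto_indicator by (rule borel_measurable_LIMSEQ_real) (rule mb)
      then show "(\<lambda>x. indicat_real {a<..<b} x *\<^sub>R u x) \<in> borel_measurable per_measure"
        by (intro borel_measurable_scaleR mu)
      show "AE x in per_measure. (\<lambda>n. bump a b (real (Suc n)) x *\<^sub>R u x)
          \<longlonglongrightarrow> indicat_real {a<..<b} x *\<^sub>R u x"
        by (intro AE_I2 tendsto_scaleR bump_tendsto_indicator tendsto_const)
      show "AE x in per_measure. norm (bump a b (real (Suc n)) x *\<^sub>R u x) \<le> norm (u x)" for n
        using bump_bounds[of a b "real (Suc n)"]
        by (intro AE_I2) (auto intro: mult_left_le_one_le)
    qed (use u in auto)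
    moreover have "(LINT x|per_measure. bump a b (real (Suc n)) x *\<^sub>R u x) = 0" for n
      using ab by (intro orth) auto
    ultimately have "(LINT x|per_measure. indicator {a<..<b} x *\<^sub>R u x) = 0"
      by (simp add: LIMSEQ_const_iff)
    moreover have "integrable per_measure (\<lambda>x. indicator {a<..<b} x *\<^sub>R u x)"
      using ab by (intro integrable_mult_indicator u) (auto simp: sets_restrict_space_iff)
    ultimately have "integral per_interval (\<lambda>x. indicator {a<..<b} x *\<^sub>R u x) = 0"
      using per_integral_eq by metis
    moreover have "(\<lambda>x. indicator {a<..<b} x *\<^sub>R u x) = (\<lambda>x. if x \<in> {a<..<b} then u x else 0)"
      by (auto simp: indicator_def)
    moreover have "integral per_interval (\<lambda>x. if x \<in> {a<..<b} then u x else 0) = integral {a<..<b} u"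
      unfolding Henstock_Kurzweil_Integration.integral_restrict_Int
      using ab by (simp add: Int_absorb2 subset_iff)
    ultimately show ?thesis
      by (simp add: integral_open_interval_real)
  qed
  \<comment> \<open>Extension by 0, because the differentiation theorem asks for integrability on
    every box of the line.\<close>
  define v where "v x = (if x \<in> per_interval then u x else 0)" for x
  have vU: "v integrable_on UNIV"
    unfolding v_def by (rule integrable_restrict_UNIV[THEN iffD2, OF ui])
  have "v integrable_on cbox a b" for a b
    using vU by (rule integrable_on_subcbox) simp
  then obtain N where N: "negligible N"
    and lim: "\<And>x e. \<lbrakk>x \<notin> N; 0 < e\<rbrakk> \<Longrightarrow> \<exists>d>0. \<forall>h. 0 < h \<and> h < d \<longrightarrow>
        norm (integral (cbox x (x + h *\<^sub>R One)) v /\<^sub>R h ^ DIM(real) - v x) < e"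
    by (rule integrable_ccontinuous_explicit) blast
  \<comment> \<open>The end points are excluded together with \<open>N\<close>, since
    \<open>zero\<close> speaks only of intervals whose ends are interior.\<close>
  have "u x = 0" if x: "x \<in> per_interval - (N \<union> {0, 2 * pi})" for x
  proof -
    have "norm (u x) \<le> e" if "e > 0" for e
    proof -
      obtain d where "d > 0" and d: "\<And>h. 0 < h \<and> h < d \<Longrightarrow>
          norm (integral (cbox x (x + h *\<^sub>R One)) v /\<^sub>R h ^ DIM(real) - v x) < e"
        using lim[of x e] x \<open>e > 0\<close> by blast
      define h where "h = min (d / 2) ((2 * pi - x) / 2)"
      have h: "0 < h" "h < d" "x + h < 2 * pi"
        using x \<open>d > 0\<close> by (auto simp: h_def min_def field_simps)
      have "integral {x..x + h} v = integral {x..x + h} u"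
        using x h by (intro Henstock_Kurzweil_Integration.integral_cong) (auto simp: v_def)
      also have "\<dots> = 0" using x h by (intro zero) auto
      finally show ?thesis
        using d[of h] h x by (simp add: v_def)
    qed
    then have "norm (u x) \<le> 0"
      by (metis add_0 field_le_epsilon)
    then show ?thesis by simp
  qed
  moreover have "negligible (N \<union> {0, 2 * pi})"
    by (rule negligible_Un[OF N negligible_finite]) simp
  ultimately show ?thesis
    unfolding AE_per_iff_negligible by blast
qed

lemma has_weak_deriv_AE_unique:
  assumes "has_weak_deriv f g" "has_weak_deriv f h"
  shows "AE x in per_measure. g x = h x"
proof -
  note g = has_weak_derivD(2)[OF assms(1)] and h = has_weak_derivD(2)[OF assms(2)]
  have "AE x in per_measure. g x - h x = 0"
  proof (rule AE_zero_if_orthogonal_to_bumps)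
    fix a b c :: real assume ab: "0 < a" "a < b" "b < 2 * pi" "c > 0"
    then have t: "bump a b c \<in> test_functions"
      by (intro bump_test_function) auto
    have i: "integrable per_measure (\<lambda>x. bump a b c x *\<^sub>R u x)" if "u \<in> L2_per" for u :: "real \<Rightarrow> 'a"
      unfolding per_integrable_iff using L2_per_integrable[OF that, unfolded per_integrable_iff]
      by (intro continuous_product_absolutely_integrable[OF bounded_bilinear_scaleR]
          test_function_primitive(4)[OF t])
    have "(LINT x|per_measure. bump a b c x *\<^sub>R g x) = (LINT x|per_measure. bump a b c x *\<^sub>R h x)"
      using has_weak_derivD(3)[OF assms(1) t] has_weak_derivD(3)[OF assms(2) t] by simp
    then show "(LINT x|per_measure. bump a b c x *\<^sub>R (g x - h x)) = 0"
      using i[OF g] i[OF h] by (simp add: scaleR_diff_right)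
  qed (intro Bochner_Integration.integrable_diff L2_per_integrable g h)
  then show ?thesis by simp
qed

lemma weak_dx_has_weak_deriv: "has_weak_deriv f g \<Longrightarrow> has_weak_deriv f (weak_dx f)"
  unfolding weak_dx_def by (rule someI[of "has_weak_deriv f"])

lemma weak_dx_AE_eq: "has_weak_deriv f g \<Longrightarrow> AE x in per_measure. weak_dx f x = g x"
  using has_weak_deriv_AE_unique weak_dx_has_weak_deriv by blast

lemma weak_dx_measurable: "has_weak_deriv f g \<Longrightarrow> weak_dx f \<in> borel_measurable per_measure"
  using L2_perD(1)[OF has_weak_derivD(2)[OF weak_dx_has_weak_deriv]] .

text \<open>Needed for \<open>tangent \<gamma>\<close>, which is built from the chosen function
  \<open>weak_dx \<gamma>\<close> and so agrees only almost everywhere with the continuous field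
  whose weak derivative is known.\<close>

lemma has_weak_deriv_cong_AE:
  assumes fg: "has_weak_deriv f g" and AE: "AE x in per_measure. f x = f' x"
    and f': "f' \<in> borel_measurable per_measure"
  shows "has_weak_deriv f' g"
proof -
  note f = has_weak_derivD(1)[OF fg]
  have L2: "f' \<in> L2_per"
    by (rule L2_perI_bound[OF f f', of 1]) (use AE in eventually_elim, simp)
  have "(LINT x|per_measure. deriv \<phi> x *\<^sub>R f x) = (LINT x|per_measure. deriv \<phi> x *\<^sub>R f' x)"
    if "\<phi> \<in> test_functions" for \<phi>
  proof (rule integral_cong_AE)
    have m: "deriv \<phi> \<in> borel_measurable per_measure"
      using test_function_primitive(5)[OF that] by blast
    show "(\<lambda>x. deriv \<phi> x *\<^sub>R f x) \<in> borel_measurable per_measure"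
      "(\<lambda>x. deriv \<phi> x *\<^sub>R f' x) \<in> borel_measurable per_measure"
      by (intro borel_measurable_scaleR m f' L2_perD(1)[OF f])+
    show "AE x in per_measure. deriv \<phi> x *\<^sub>R f x = deriv \<phi> x *\<^sub>R f' x"
      using AE by eventually_elim simp
  qed
  then show ?thesis
    using has_weak_derivD[OF fg] L2 by (simp add: has_weak_deriv_def)
qed

text \<open>The du Bois-Reymond lemma. The difference \<open>k\<close> of \<open>f\<close> and an
  indefinite integral of \<open>g\<close> is orthogonal to all derivatives of test functions. Every
  bump is such a derivative up to a multiple of one reference bump \<open>\<psi>\<close>, so
  subtracting a suitable constant from \<open>k\<close> makes it orthogonal to all bumps.\<close>

lemma has_weak_deriv_AE_primitive:
  fixes f :: "real \<Rightarrow> 'a::euclidean_space"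
  assumes fg: "has_weak_deriv f g"
  obtains F where "primitive_on 0 (2 * pi) F g" "AE x in per_measure. f x = F x"
proof -
  note f = has_weak_derivD(1)[OF fg] and g = has_weak_derivD(2)[OF fg] and weak = has_weak_derivD(3)[OF fg]
  have gi: "g absolutely_integrable_on per_interval"
    using L2_per_integrable[OF g] by (simp add: per_integrable_iff)
  have prim: "primitive_on 0 (2 * pi) (\<lambda>x. c + integral {0..x} g) g" for c
    using gi by (simp add: primitive_on_def)
  \<comment> \<open>Written with \<open>0 +\<close> so that \<open>prim\<close> matches with
    \<open>c = 0\<close>.\<close>
  define P where "P x = 0 + integral {0..x} g" for x
  have P: "primitive_on 0 (2 * pi) P g" unfolding P_def by (rule prim)
  define k where "k x = f x - P x" for x
  have ki: "integrable per_measure k"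
    unfolding k_def
    by (intro Bochner_Integration.integrable_diff L2_per_integrable f continuous_on_per_integrable
        primitive_on_continuous[OF P])
  have mult_i: "integrable per_measure (\<lambda>x. \<theta> x *\<^sub>R u x)"
    if "continuous_on per_interval \<theta>" "integrable per_measure u"
    for \<theta> :: "real \<Rightarrow> real" and u :: "real \<Rightarrow> 'a"
    using that unfolding per_integrable_iff
    by (intro continuous_product_absolutely_integrable[OF bounded_bilinear_scaleR])
  have kt: "(LINT x|per_measure. deriv \<phi> x *\<^sub>R k x) = 0" if t: "\<phi> \<in> test_functions" for \<phi>
  proof -
    have c: "continuous_on per_interval (deriv \<phi>)" by (rule test_function_primitive(5)[OF t])
    have "(LINT x|per_measure. deriv \<phi> x *\<^sub>R k x) =
       (LINT x|per_measure. deriv \<phi> x *\<^sub>R f x - deriv \<phi> x *\<^sub>R P x)"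
      by (simp add: k_def scaleR_diff_right)
    also have "\<dots> = (LINT x|per_measure. deriv \<phi> x *\<^sub>R f x) - (LINT x|per_measure. deriv \<phi> x *\<^sub>R P x)"
      by (intro Bochner_Integration.integral_diff mult_i c L2_per_integrable f continuous_on_per_integrable
          primitive_on_continuous[OF P])
    also have "\<dots> = 0"
      using weak[OF t] primitive_on_times_test_function[OF P t] by simp
    finally show ?thesis .
  qed
  \<comment> \<open>Any bump inside the interval with nonzero integral would do;
    \<open>{1..2}\<close> fits because \<open>2 < 2 * pi\<close>, and the midpoint
    \<open>3 / 2\<close> witnesses that it is not identically 0.\<close>
  define \<psi> where "\<psi> = bump 1 2 1"
  have \<psi>c: "continuous_on S \<psi>" for S
    unfolding \<psi>_def by (rule smooth_gen_continuous_on[OF smooth_gen_bump])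
  have pi2: "2 < 2 * pi" using pi_gt3 by simp
  define I where "I = integral per_interval \<psi>"
  have "I \<noteq> 0"
  proof
    assume "I = 0"
    then have "\<forall>x\<in>per_interval. \<psi> x = 0"
      using integral_eq_0_iff[OF \<psi>c, of 0 "2 * pi"] bump_bounds(1)
      unfolding I_def \<psi>_def by simp
    then have "\<psi> (3 / 2) = 0" using pi2 by auto
    then show False using bump_pos[of 1 "3 / 2" 1 2] by (simp add: \<psi>_def)
  qed
  \<comment> \<open>The \<open>\<psi>\<close>-weighted mean of \<open>k\<close>, which is the value
    of \<open>k\<close> if \<open>k\<close> is constant.\<close>
  define c where "c = (LINT x|per_measure. \<psi> x *\<^sub>R k x) /\<^sub>R I"
  have "AE x in per_measure. k x - c = 0"
  proof (rule AE_zero_if_orthogonal_to_bumps)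
    show "integrable per_measure (\<lambda>x. k x - c)"
      by (intro Bochner_Integration.integrable_diff ki finite_measure.integrable_const per_measure_finite)
    fix a b e :: real assume ab: "0 < a" "a < b" "b < 2 * pi" "e > 0"
    \<comment> \<open>Subtracting the multiple of \<open>\<psi>\<close> with the same integral from \<open>h\<close> makes it the derivative of a test function.\<close>
    define h where "h = bump a b e"
    have hc: "continuous_on S h" for S
      unfolding h_def by (rule smooth_gen_continuous_on[OF smooth_gen_bump])
    define J where "J = integral per_interval h"
    define \<theta> where "\<theta> x = h x + (- (J / I)) * \<psi> x" for x
    have "smooth_gen \<theta>"
      unfolding \<theta>_def[abs_def] h_def \<psi>_def by (intro smooth_gen.add smooth_gen.scale smooth_gen_bump)
    moreover have "\<theta> x = 0" if "x < min a 1 \<or> max b 2 < x" for x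
      using that ab by (auto simp: \<theta>_def h_def \<psi>_def bump_outside)
    moreover have "integral per_interval \<theta> = J + (- (J / I)) * I"
    proof (rule integral_unique)
      have "(h has_integral J) per_interval" "(\<psi> has_integral I) per_interval"
        unfolding J_def I_def by (rule integrable_integral[OF integrable_continuous_real[OF hc]]
            integrable_integral[OF integrable_continuous_real[OF \<psi>c]])+
      then show "(\<theta> has_integral J + (- (J / I)) * I) per_interval"
        unfolding \<theta>_def by (intro has_integral_add has_integral_mult_right)
    qed
    ultimately obtain \<phi> where "\<phi> \<in> test_functions" "deriv \<phi> = \<theta>"
      using antiderivative_test_function[of \<theta> "min a 1" "max b 2"] ab pi2 \<open>I \<noteq> 0\<close> by auto
    with kt have "0 = (LINT x|per_measure. \<theta> x *\<^sub>R k x)" by metis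
    also have "\<dots> = (LINT x|per_measure. h x *\<^sub>R k x - (J / I) *\<^sub>R (\<psi> x *\<^sub>R k x))"
      by (simp add: \<theta>_def algebra_simps)
    also have "\<dots> = (LINT x|per_measure. h x *\<^sub>R k x) - (LINT x|per_measure. (J / I) *\<^sub>R (\<psi> x *\<^sub>R k x))"
      by (intro Bochner_Integration.integral_diff integrable_scaleR_right mult_i hc \<psi>c ki)
    also have "\<dots> = (LINT x|per_measure. h x *\<^sub>R k x) - J *\<^sub>R c"
      unfolding Bochner_Integration.integral_scaleR_right c_def using \<open>I \<noteq> 0\<close> by (simp add: divide_inverse)
    finally have "(LINT x|per_measure. h x *\<^sub>R k x) = J *\<^sub>R c" by simp
    moreover have "(LINT x|per_measure. h x *\<^sub>R c) = J *\<^sub>R c"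
      unfolding J_def
      by (subst integral_scaleR_left)
        (auto intro!: continuous_on_per_integrable hc per_integral_eq arg_cong2[where f = scaleR])
    moreover have "(LINT x|per_measure. h x *\<^sub>R (k x - c)) =
        (LINT x|per_measure. h x *\<^sub>R k x) - (LINT x|per_measure. h x *\<^sub>R c)"
      unfolding scaleR_diff_right
      by (intro Bochner_Integration.integral_diff mult_i hc ki finite_measure.integrable_const per_measure_finite)
    ultimately show "(LINT x|per_measure. bump a b e x *\<^sub>R (k x - c)) = 0"
      by (simp add: h_def)
  qed
  then have "AE x in per_measure. f x = c + integral {0..x} g"
    by eventually_elim (simp add: k_def P_def algebra_simps)
  then show ?thesis using that prim by blast
qed

lemma continuous_on_AE_eq:
  fixes f g :: "real \<Rightarrow> 'a::euclidean_space"
  assumes "continuous_on per_interval f" "continuous_on per_interval g"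
    and AE: "AE x in per_measure. f x = g x" and x: "x \<in> per_interval"
  shows "f x = g x"
proof -
  have c: "continuous_on per_interval (\<lambda>x. norm (f x - g x))"
    using assms(1,2) by (intro continuous_intros)
  have "(LINT x|per_measure. norm (f x - g x)) = 0"
    by (rule integral_eq_zero_AE) (use AE in eventually_elim, simp)
  then have "integral per_interval (\<lambda>x. norm (f x - g x)) = 0"
    using per_integral_eq[OF continuous_on_per_integrable[OF c]] by simp
  then show ?thesis
    using integral_eq_0_iff[of 0 "2 * pi" "\<lambda>x. norm (f x - g x)"] c x by auto
qed

lemma has_weak_deriv_continuous_primitive:
  assumes "has_weak_deriv f g" "continuous_on per_interval f"
  shows "primitive_on 0 (2 * pi) f g"
proof -
  obtain F where F: "primitive_on 0 (2 * pi) F g" "AE x in per_measure. f x = F x"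
    using has_weak_deriv_AE_primitive[OF assms(1)] .
  have "F x = f x" if "x \<in> per_interval" for x
    using continuous_on_AE_eq[OF assms(2) primitive_on_continuous[OF F(1)] F(2) that] by simp
  then show ?thesis by (intro primitive_on_cong[OF F(1)]) auto
qed

section \<open>Curves given by speed and tangent angle\<close>

definition circ :: "real \<Rightarrow> real^2" where
  "circ t = vector [cos t, sin t]"

lemma circ_nth [simp]: "circ t $ 1 = cos t" "circ t $ 2 = sin t"
  by (simp_all add: circ_def)

lemma rot_nth [simp]: "rot v $ 1 = - v $ 2" "rot v $ 2 = v $ 1"
  by (simp_all add: rot_def)

lemma norm_circ [simp]: "norm (circ t) = 1"
  by (simp add: norm_eq_sqrt_inner inner_vec_def sum_2 flip: power2_eq_square)

lemma circ_nonzero [simp]: "circ t \<noteq> 0"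
  by (metis norm_circ norm_zero zero_neq_one)

lemma circ_inner_self [simp]: "circ t \<bullet> circ t = 1"
  by (simp add: dot_square_norm)

lemma rot_circ: "rot (circ t) = circ (t + pi / 2)"
  by (simp add: vec_eq_iff forall_2 cos_add sin_add)

lemma continuous_on_circ [continuous_intros]:
  fixes S :: "real set"
  assumes "continuous_on S f"
  shows "continuous_on S (\<lambda>x. circ (f x))"
proof -
  have "(\<lambda>x. circ (f x)) = (\<lambda>x. \<chi> i. if i = 1 then cos (f x) else sin (f x))"
    by (auto simp: vec_eq_iff forall_2 fun_eq_iff)
  moreover have "continuous_on S (\<lambda>x. if i = 1 then cos (f x) else sin (f x))" for i :: 2
    using assms by (cases "i = 1") (auto intro: continuous_on_cos continuous_on_sin)
  ultimately show ?thesis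
    by (simp only: continuous_on_vec_lambda)
qed

section \<open>The plane as the complex numbers\<close>

definition complex_of_vec :: "real^2 \<Rightarrow> complex" where
  "complex_of_vec v = Complex (v $ 1) (v $ 2)"

definition vec_of_complex :: "complex \<Rightarrow> real^2" where
  "vec_of_complex z = vector [Re z, Im z]"

lemma bounded_linear_complex_of_vec: "bounded_linear complex_of_vec"
  by (rule linear_conv_bounded_linear[THEN iffD1], rule linearI)
    (simp_all add: complex_of_vec_def complex_eq_iff)

lemma bounded_linear_vec_of_complex: "bounded_linear vec_of_complex"
  by (rule linear_conv_bounded_linear[THEN iffD1], rule linearI)
    (simp_all add: vec_of_complex_def vec_eq_iff forall_2)

lemma vec_of_complex_of_vec [simp]: "vec_of_complex (complex_of_vec v) = v"
  by (simp add: complex_of_vec_def vec_of_complex_def vec_eq_iff forall_2)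

lemma vec_of_complex_exp: "vec_of_complex (exp z) = exp (Re z) *\<^sub>R circ (Im z)"
  by (simp add: vec_of_complex_def vec_eq_iff forall_2 Re_exp Im_exp)

lemma norm_complex_of_vec [simp]: "norm (complex_of_vec v) = norm v"
  by (simp add: complex_of_vec_def cmod_def norm_eq_sqrt_inner inner_vec_def sum_2 power2_eq_square)

lemma complex_of_vec_eq_0 [simp]: "complex_of_vec v = 0 \<longleftrightarrow> v = 0"
  by (metis norm_complex_of_vec norm_eq_zero)

text \<open>\<open>circ t\<close> corresponds to \<open>exp (\<i> * t)\<close> and
  \<open>rot\<close> to multiplication by \<open>\<i>\<close>, so this is the exponential rule along
  the imaginary axis.\<close>

lemma primitive_on_circ:
  assumes "primitive_on a b \<theta> k"
  shows "primitive_on a b (\<lambda>x. circ (\<theta> x)) (\<lambda>x. k x *\<^sub>R rot (circ (\<theta> x)))"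
proof -
  have "bounded_linear (\<lambda>r. \<i> * complex_of_real r)"
    by (intro bounded_linear_intros bounded_linear_of_real)
  from primitive_on_bounded_linear[OF primitive_on_exp[OF primitive_on_bounded_linear[OF assms this]]
      bounded_linear_vec_of_complex]
  show ?thesis
    by (rule primitive_on_cong)
      (simp_all add: vec_of_complex_def vec_eq_iff forall_2 Re_exp Im_exp)
qed

text \<open>Measurability of \<open>f\<close> is not assumed: the integrands of the energy contain \<open>curvature\<close>, a description
  that need not denote on a null set.\<close>

lemma integrable_cong_AE_per:
  fixes f g :: "real \<Rightarrow> 'a::euclidean_space"
  assumes g: "integrable per_measure g" and AE: "AE x in per_measure. f x = g x"
  shows "integrable per_measure f" "(LINT x|per_measure. f x) = (LINT x|per_measure. g x)"
proof -
  obtain N where N: "negligible N" "\<And>x. x \<in> per_interval - N \<Longrightarrow> f x = g x"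
    using AE unfolding AE_per_iff_negligible by blast
  show f: "integrable per_measure f"
    using absolutely_integrable_spike[OF g[unfolded per_integrable_iff] N]
    by (simp add: per_integrable_iff)
  show "(LINT x|per_measure. f x) = (LINT x|per_measure. g x)"
    using f g AE by (intro integral_cong_AE) auto
qed

lemma L2_per_add:
  assumes "f \<in> L2_per" "g \<in> L2_per"
  shows "(\<lambda>x. f x + g x) \<in> L2_per"
proof -
  have m: "(\<lambda>x. f x + g x) \<in> borel_measurable per_measure"
    using assms L2_perD(1) by (intro borel_measurable_add) auto
  have "integrable per_measure (\<lambda>x. 2 * (norm (f x))\<^sup>2 + 2 * (norm (g x))\<^sup>2)"
    using assms L2_perD(2) by (intro Bochner_Integration.integrable_add integrable_mult_right) auto
  then have "integrable per_measure (\<lambda>x. (norm (f x + g x))\<^sup>2)"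
  proof (rule Bochner_Integration.integrable_bound)
    have "(norm (u + v))\<^sup>2 \<le> 2 * (norm u)\<^sup>2 + 2 * (norm v)\<^sup>2" for u v :: 'a
    proof -
      have "(norm (u + v))\<^sup>2 \<le> (norm u + norm v)\<^sup>2"
        by (intro power_mono norm_triangle_ineq) auto
      also have "\<dots> \<le> 2 * (norm u)\<^sup>2 + 2 * (norm v)\<^sup>2"
        using zero_le_power2[of "norm u - norm v"] by (simp add: power2_sum power2_diff)
      finally show ?thesis .
    qed
    then show "AE x in per_measure. norm ((norm (f x + g x))\<^sup>2)
        \<le> norm (2 * (norm (f x))\<^sup>2 + 2 * (norm (g x))\<^sup>2)" by simp
  qed (use m in measurable)
  with m show ?thesis by (simp add: L2_per_def)
qed

lemma L2_per_cmult: "f \<in> L2_per \<Longrightarrow> (\<lambda>x. c * f x) \<in> L2_per" for f :: "real \<Rightarrow> real"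
  by (rule L2_perI_bound[of f _ "\<bar>c\<bar>"]) (auto simp: abs_mult dest: L2_perD(1))

lemma L2_per_square_weight_integrable:
  fixes f :: "real \<Rightarrow> 'a::euclidean_space"
  assumes "f \<in> L2_per" "continuous_on per_interval w" "\<And>x. x \<in> per_interval \<Longrightarrow> w x > 0"
  shows "integrable per_measure (\<lambda>x. (norm (f x))\<^sup>2 / w x)"
proof -
  have "continuous_on per_interval (\<lambda>x. inverse (w x))"
    using assms(2,3) by (intro continuous_on_inverse) (auto simp: less_le)
  from continuous_product_absolutely_integrable[OF bounded_bilinear_mult this
      L2_perD(2)[OF assms(1), unfolded per_integrable_iff]]
  show ?thesis
    unfolding per_integrable_iff divide_inverse mult.commute[of _ "inverse _"] .
qed

text \<open>Polar form of the velocity: speed \<open>w\<close> and tangent angle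
  \<open>\<theta>\<close>. The density \<open>k\<close> is the derivative of the angle in the
  parameter \<open>x\<close>, not in arc length. The velocity is prescribed only almost everywhere,
  so both an arbitrary curve of the class and the explicit circle are instances.\<close>

locale framed_curve =
  fixes \<gamma> :: "real \<Rightarrow> real^2" and w \<theta> k :: "real \<Rightarrow> real"
  assumes weak_dx_AE: "AE x in per_measure. weak_dx \<gamma> x = w x *\<^sub>R circ (\<theta> x)"
    and dx_measurable: "weak_dx \<gamma> \<in> borel_measurable per_measure"
    and w_cont: "continuous_on per_interval w"
    and w_pos: "\<And>x. x \<in> per_interval \<Longrightarrow> w x > 0"
    and \<theta>_prim: "primitive_on 0 (2 * pi) \<theta> k"
    and k_L2: "k \<in> L2_per"
begin

lemma \<theta>_cont: "continuous_on per_interval \<theta>"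
  by (rule primitive_on_continuous[OF \<theta>_prim])

lemma norm_dx_AE: "AE x in per_measure. norm (weak_dx \<gamma> x) = w x"
  using weak_dx_AE AE_per_in_interval by eventually_elim (use w_pos in \<open>simp add: less_imp_le\<close>)

lemma tangent_AE: "AE x in per_measure. tangent \<gamma> x = circ (\<theta> x)"
  using weak_dx_AE norm_dx_AE AE_per_in_interval
  by eventually_elim (use w_pos in \<open>force simp: tangent_def ds_def\<close>)

lemma tangent_has_weak_deriv: "has_weak_deriv (tangent \<gamma>) (\<lambda>x. k x *\<^sub>R rot (circ (\<theta> x)))"
proof (rule has_weak_deriv_cong_AE[OF primitive_on_has_weak_deriv])
  show P: "primitive_on 0 (2 * pi) (\<lambda>x. circ (\<theta> x)) (\<lambda>x. k x *\<^sub>R rot (circ (\<theta> x)))"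
    by (rule primitive_on_circ[OF \<theta>_prim])
  show "(\<lambda>x. k x *\<^sub>R rot (circ (\<theta> x))) \<in> L2_per"
  proof (rule L2_perI_bound[OF k_L2, of _ 1])
    show "(\<lambda>x. k x *\<^sub>R rot (circ (\<theta> x))) \<in> borel_measurable per_measure"
      using primitive_on_absolutely_integrable[OF P] by (auto simp flip: per_integrable_iff)
    show "AE x in per_measure. norm (k x *\<^sub>R rot (circ (\<theta> x))) \<le> 1 * norm (k x)"
      by (simp add: rot_circ)
  qed
  show "AE x in per_measure. circ (\<theta> x) = tangent \<gamma> x"
    using tangent_AE by eventually_elim simp
  show "tangent \<gamma> \<in> borel_measurable per_measure"
    unfolding tangent_def ds_def[abs_def] using dx_measurable by measurable
qed

text \<open>The description in \<open>curvature\<close> denotes wherever the normal is nonzero,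
  which holds almost everywhere because the tangent there is a unit vector. Passing from
  \<open>x\<close> to arc length divides \<open>k\<close> by the speed.\<close>

lemma curvature_AE: "AE x in per_measure. curvature \<gamma> x = k x / w x"
  using weak_dx_AE_eq[OF tangent_has_weak_deriv] norm_dx_AE tangent_AE
proof eventually_elim
  case (elim x)
  have "ds \<gamma> (tangent \<gamma>) x = (k x / w x) *\<^sub>R unit_normal \<gamma> x"
    by (simp add: ds_def elim unit_normal_def divide_inverse mult.commute)
  moreover have "unit_normal \<gamma> x \<noteq> 0"
    by (simp add: unit_normal_def elim rot_circ)
  ultimately show ?case
    unfolding curvature_def by (intro the_equality) auto
qed

text \<open>Each quadratic integrand carries \<open>1 / w\<close> twice from \<open>ds\<close> and
  \<open>w\<close> once from the length element, leaving a single division by \<open>w\<close>.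
  Integrability is proved alongside so that the three integrals can be merged and compared under one
  integral sign.\<close>

lemma energy_terms:
  assumes \<eta>: "has_weak_deriv \<eta> \<zeta>"
  shows "integrable per_measure (\<lambda>x. (k x + \<delta> * (\<zeta> x \<bullet> circ (\<theta> x)))\<^sup>2 / w x)"
    and "integrable per_measure (\<lambda>x. (norm (\<zeta> x))\<^sup>2 / w x)"
    and "integrable per_measure w"
    and "E_LM \<delta> lam \<gamma> \<eta> =
      1 / 2 * (LINT x|per_measure. (k x + \<delta> * (\<zeta> x \<bullet> circ (\<theta> x)))\<^sup>2 / w x)
      + lam / 2 * (LINT x|per_measure. (norm (\<zeta> x))\<^sup>2 / w x) + (LINT x|per_measure. w x)"
proof -
  note \<zeta> = has_weak_derivD(2)[OF \<eta>]
  have "(\<lambda>x. \<zeta> x \<bullet> circ (\<theta> x)) \<in> L2_per"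
  proof (rule L2_perI_bound[OF \<zeta>, of _ 1])
    show "(\<lambda>x. \<zeta> x \<bullet> circ (\<theta> x)) \<in> borel_measurable per_measure"
      by (intro borel_measurable_inner L2_perD(1)[OF \<zeta>] continuous_on_measurable_per
          continuous_intros \<theta>_cont)
    show "AE x in per_measure. norm (\<zeta> x \<bullet> circ (\<theta> x)) \<le> 1 * norm (\<zeta> x)"
      using Cauchy_Schwarz_ineq2[of "\<zeta> _" "circ _"] by simp
  qed
  then have L: "(\<lambda>x. k x + \<delta> * (\<zeta> x \<bullet> circ (\<theta> x))) \<in> L2_per"
    by (intro L2_per_add k_L2 L2_per_cmult)
  show i1: "integrable per_measure (\<lambda>x. (k x + \<delta> * (\<zeta> x \<bullet> circ (\<theta> x)))\<^sup>2 / w x)"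
    using L2_per_square_weight_integrable[OF L w_cont w_pos] by simp
  show i2: "integrable per_measure (\<lambda>x. (norm (\<zeta> x))\<^sup>2 / w x)"
    by (rule L2_per_square_weight_integrable[OF \<zeta> w_cont w_pos])
  show i3: "integrable per_measure w"
    by (rule continuous_on_per_integrable[OF w_cont])
  have "AE x in per_measure. (curvature \<gamma> x + \<delta> * curve_div \<gamma> \<eta> x)\<^sup>2 * norm (weak_dx \<gamma> x) =
      (k x + \<delta> * (\<zeta> x \<bullet> circ (\<theta> x)))\<^sup>2 / w x"
    using weak_dx_AE_eq[OF \<eta>] norm_dx_AE tangent_AE curvature_AE AE_per_in_interval
  proof eventually_elim
    case (elim x)
    then have "w x > 0" using w_pos by blast
    moreover have "curve_div \<gamma> \<eta> x = (\<zeta> x \<bullet> circ (\<theta> x)) / w x"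
      by (simp add: curve_div_def ds_def elim divide_inverse mult.commute)
    moreover have "(c / v + \<delta> * (d / v))\<^sup>2 * v = (c + \<delta> * d)\<^sup>2 / v" if "v > 0" for c d v :: real
      using that by (simp add: power2_eq_square field_simps)
    ultimately show ?case
      by (simp only: elim)
  qed
  note E1 = integrable_cong_AE_per(2)[OF i1 this]
  \<comment> \<open>The Frobenius norm of a rank-one matrix is the product of the norms of its two
    factors.\<close>
  have grad: "(norm (curve_grad \<gamma> \<eta> x))\<^sup>2 = (norm (ds \<gamma> \<eta> x))\<^sup>2 * (norm (tangent \<gamma> x))\<^sup>2" for x
    by (simp add: curve_grad_def power2_norm_eq_inner inner_vec_def sum_2) (simp add: algebra_simps)
  have "AE x in per_measure. (norm (curve_grad \<gamma> \<eta> x))\<^sup>2 * norm (weak_dx \<gamma> x) = (norm (\<zeta> x))\<^sup>2 / w x"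
    using weak_dx_AE_eq[OF \<eta>] norm_dx_AE tangent_AE AE_per_in_interval
  proof eventually_elim
    case (elim x)
    then have "w x > 0" using w_pos by blast
    then show ?case
      unfolding grad using elim by (simp add: ds_def power2_eq_square field_simps)
  qed
  note E2 = integrable_cong_AE_per(2)[OF i2 this]
  have "AE x in per_measure. 1 * norm (weak_dx \<gamma> x) = w x"
    using norm_dx_AE by eventually_elim simp
  note E3 = integrable_cong_AE_per(2)[OF i3 this]
  show "E_LM \<delta> lam \<gamma> \<eta> =
      1 / 2 * (LINT x|per_measure. (k x + \<delta> * (\<zeta> x \<bullet> circ (\<theta> x)))\<^sup>2 / w x)
      + lam / 2 * (LINT x|per_measure. (norm (\<zeta> x))\<^sup>2 / w x) + (LINT x|per_measure. w x)"
    unfolding E_LM_def curve_length_def curve_integral_def E1 E2 E3 ..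
qed

text \<open>The bound holds pointwise in \<open>x\<close> before integration. Only the tangential
  part of \<open>\<zeta>\<close> is coupled to the curvature; its normal part can only increase the
  gradient term. The number \<open>2 * R^2\<close> is the minimum of
  \<open>(1 + \<delta> t)^2 + lam t^2\<close> over real \<open>t\<close>.\<close>

lemma energy_ge_total_curvature:
  assumes \<eta>: "has_weak_deriv \<eta> \<zeta>" and "lam > 0" and R: "R > 0" "R\<^sup>2 = lam / (2 * (lam + \<delta>\<^sup>2))"
  shows "2 * R * (LINT x|per_measure. \<bar>k x\<bar>) \<le> E_LM \<delta> lam \<gamma> \<eta>"
proof -
  note e = energy_terms[OF \<eta>]
  have "2 * R * (LINT x|per_measure. \<bar>k x\<bar>) = (LINT x|per_measure. 2 * R * \<bar>k x\<bar>)"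
    by simp
  also have "\<dots> \<le> (LINT x|per_measure. 1 / 2 * ((k x + \<delta> * (\<zeta> x \<bullet> circ (\<theta> x)))\<^sup>2 / w x)
      + lam / 2 * ((norm (\<zeta> x))\<^sup>2 / w x) + w x)"
  proof (rule integral_mono_AE)
    show "integrable per_measure (\<lambda>x. 2 * R * \<bar>k x\<bar>)"
      using L2_per_integrable[OF k_L2] by (intro integrable_mult_right integrable_abs)
    show "integrable per_measure (\<lambda>x. 1 / 2 * ((k x + \<delta> * (\<zeta> x \<bullet> circ (\<theta> x)))\<^sup>2 / w x)
      + lam / 2 * ((norm (\<zeta> x))\<^sup>2 / w x) + w x)"
      by (intro Bochner_Integration.integrable_add integrable_mult_right e)
    show "AE x in per_measure. 2 * R * \<bar>k x\<bar> \<le>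
        1 / 2 * ((k x + \<delta> * (\<zeta> x \<bullet> circ (\<theta> x)))\<^sup>2 / w x) + lam / 2 * ((norm (\<zeta> x))\<^sup>2 / w x) + w x"
      using AE_per_in_interval
    proof eventually_elim
      case (elim x)
      define a where "a = \<zeta> x \<bullet> circ (\<theta> x)"
      have w: "w x > 0" using w_pos elim by blast
      have "\<bar>a\<bar> \<le> norm (\<zeta> x)"
        using Cauchy_Schwarz_ineq2[of "\<zeta> x" "circ (\<theta> x)"] by (simp add: a_def)
      then have a: "a\<^sup>2 \<le> (norm (\<zeta> x))\<^sup>2"
        by (simp add: abs_le_square_iff[symmetric])
      have S: "lam + \<delta>\<^sup>2 > 0" using \<open>lam > 0\<close> by (simp add: add_pos_nonneg)
      \<comment> \<open>The square vanishes at
        \<open>a = - \<delta> * k x / (lam + \<delta>^2)\<close>, the minimum point of the quadratic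
        in \<open>a\<close> that is being bounded.\<close>
      have "0 \<le> (\<delta> * k x + (lam + \<delta>\<^sup>2) * a)\<^sup>2" by simp
      also have "\<dots> = (lam + \<delta>\<^sup>2) * ((k x + \<delta> * a)\<^sup>2 + lam * a\<^sup>2) - lam * (k x)\<^sup>2"
        by (simp add: power2_eq_square algebra_simps)
      finally have "2 * R\<^sup>2 * (k x)\<^sup>2 \<le> (k x + \<delta> * a)\<^sup>2 + lam * a\<^sup>2"
        unfolding R(2) using S by (simp add: field_simps)
      also have "\<dots> \<le> (k x + \<delta> * a)\<^sup>2 + lam * (norm (\<zeta> x))\<^sup>2"
        using a \<open>lam > 0\<close> by simp
      finally have "R\<^sup>2 * (k x)\<^sup>2 \<le> ((k x + \<delta> * a)\<^sup>2 + lam * (norm (\<zeta> x))\<^sup>2) / 2" by simp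
      \<comment> \<open>AM-GM after multiplication by the speed, with equality exactly if
        \<open>w x = R * \<bar>k x\<bar>\<close>.\<close>
      moreover have "0 \<le> (R * \<bar>k x\<bar> - w x)\<^sup>2" by simp
      ultimately have "2 * R * \<bar>k x\<bar> * w x \<le> ((k x + \<delta> * a)\<^sup>2 + lam * (norm (\<zeta> x))\<^sup>2) / 2 + w x * w x"
        unfolding power2_diff power_mult_distrib power2_abs power2_eq_square[of "w x"] mult.assoc[symmetric]
        by linarith
      then have "2 * R * \<bar>k x\<bar> \<le> (((k x + \<delta> * a)\<^sup>2 + lam * (norm (\<zeta> x))\<^sup>2) / 2 + w x * w x) / w x"
        using w by (simp add: pos_le_divide_eq)
      then show ?case
        using w by (simp add: a_def add_divide_distrib)
    qed
  qed
  also have "\<dots> = E_LM \<delta> lam \<gamma> \<eta>"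
    unfolding e(4)
    by (simp only: Bochner_Integration.integral_add Bochner_Integration.integrable_add
        integrable_mult_right e(1-3) Bochner_Integration.integral_mult_right_zero)
  finally show ?thesis .
qed

end

text \<open>Fenchel's inequality in terms of the angle. Equal end tangents make the total turning
  \<open>2 * pi * n\<close>. If \<open>n\<close> is nonzero, the net turning already suffices. If
  \<open>n = 0\<close>, the angle must sweep a range of at least \<open>pi\<close> for the curve to
  close, and as it returns to its initial value it covers that range twice.\<close>

lemma closed_curve_total_curvature_ge:
  assumes \<theta>: "primitive_on 0 (2 * pi) \<theta> k"
    and w: "continuous_on per_interval w" "\<And>x. x \<in> per_interval \<Longrightarrow> w x > 0"
    and closed: "integral per_interval (\<lambda>x. w x *\<^sub>R circ (\<theta> x)) = 0"
    and ends: "circ (\<theta> 0) = circ (\<theta> (2 * pi))"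
  shows "2 * pi \<le> integral per_interval (\<lambda>x. \<bar>k x\<bar>)"
proof -
  have c\<theta>: "continuous_on per_interval \<theta>" by (rule primitive_on_continuous[OF \<theta>])
  have ki: "(\<lambda>x. \<bar>k x\<bar>) integrable_on per_interval"
    using primitive_on_absolutely_integrable[OF \<theta>] by (simp add: absolutely_integrable_on_def)
  have var: "\<bar>\<theta> y - \<theta> x\<bar> \<le> integral {x..y} (\<lambda>x. \<bar>k x\<bar>)" if "0 \<le> x" "x \<le> y" "y \<le> 2 * pi" for x y
    using primitive_on_norm_diff[OF \<theta> that] by simp
  have "cos (\<theta> (2 * pi)) = cos (\<theta> 0) \<and> sin (\<theta> (2 * pi)) = sin (\<theta> 0)"
    using ends by (metis circ_nth)
  then obtain n :: int where n: "\<theta> (2 * pi) = \<theta> 0 + 2 * pi * of_int n"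
    using sin_cos_eq_iff by metis
  show ?thesis
  proof (cases "n = 0")
    case False
    then have "1 \<le> \<bar>real_of_int n\<bar>" by linarith
    then have "2 * pi * 1 \<le> 2 * pi * \<bar>real_of_int n\<bar>"
      by (intro mult_left_mono) auto
    also have "\<dots> = \<bar>\<theta> (2 * pi) - \<theta> 0\<bar>"
      unfolding n by (simp add: abs_mult)
    also have "\<dots> \<le> integral per_interval (\<lambda>x. \<bar>k x\<bar>)"
      by (intro var) auto
    finally show ?thesis by simp
  next
    case True
    then have per: "\<theta> (2 * pi) = \<theta> 0" using n by simp
    obtain p where p: "p \<in> per_interval" "\<And>x. x \<in> per_interval \<Longrightarrow> \<theta> x \<le> \<theta> p"
      using continuous_attains_sup[OF compact_Icc _ c\<theta>] by auto
    obtain q where q: "q \<in> per_interval" "\<And>x. x \<in> per_interval \<Longrightarrow> \<theta> q \<le> \<theta> x"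
      using continuous_attains_inf[OF compact_Icc _ c\<theta>] by auto
    \<comment> \<open>Otherwise the tangent stays in an open half-plane and the curve cannot close up.\<close>
    have osc: "pi \<le> \<theta> p - \<theta> q"
    proof (rule ccontr)
      assume neg: "\<not> pi \<le> \<theta> p - \<theta> q"
      define m where "m = (\<theta> p + \<theta> q) / 2"
      have pos: "w x * cos (\<theta> x - m) > 0" if "x \<in> per_interval" for x
      proof (intro mult_pos_pos w that cos_gt_zero_pi)
        show "- (pi / 2) < \<theta> x - m" "\<theta> x - m < pi / 2"
          using p(2)[OF that] q(2)[OF that] neg by (auto simp: m_def field_simps)
      qed
      have cont: "continuous_on per_interval (\<lambda>x. w x *\<^sub>R circ (\<theta> x))"
        by (intro continuous_intros w c\<theta>)
      have hi: "((\<lambda>x. (w x *\<^sub>R circ (\<theta> x)) \<bullet> circ m) has_integral 0 \<bullet> circ m) per_interval"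
        using has_integral_linear[OF integrable_integral[OF integrable_continuous_real[OF cont]]
            bounded_linear_inner_left[of "circ m"]]
        unfolding closed by (simp add: o_def)
      have ip: "(w x *\<^sub>R circ (\<theta> x)) \<bullet> circ m = w x * cos (\<theta> x - m)" for x
        by (simp add: inner_vec_def sum_2 cos_diff algebra_simps)
      have "integral per_interval (\<lambda>x. w x * cos (\<theta> x - m)) = 0"
        using hi unfolding ip inner_zero_left by (rule integral_unique)
      moreover have "continuous_on per_interval (\<lambda>x. w x * cos (\<theta> x - m))"
        by (intro continuous_intros w c\<theta>)
      ultimately have "\<forall>x\<in>per_interval. w x * cos (\<theta> x - m) = 0"
        using integral_eq_0_iff[of 0 "2 * pi" "\<lambda>x. w x * cos (\<theta> x - m)"] pos by (simp add: less_imp_le)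
      then have "w p * cos (\<theta> p - m) = 0" using p(1) by (rule bspec)
      then show False using pos[OF p(1)] by linarith
    qed
    \<comment> \<open>The middle piece between the two extremal points contributes
      \<open>\<theta> p - \<theta> q\<close>. The two outer pieces together contribute as much
      again, because \<open>\<theta> 0 = \<theta> (2 * pi)\<close> joins them into one path between
      the extrema. The unordered pair covers both orders of maximum and minimum.\<close>
    have three: "2 * (\<theta> p - \<theta> q) \<le> integral per_interval (\<lambda>x. \<bar>k x\<bar>)"
      if xy: "x \<in> per_interval" "y \<in> per_interval" "x \<le> y" and "{x, y} = {p, q}" for x y
    proof -
      have i: "(\<lambda>x. \<bar>k x\<bar>) integrable_on {0..y}"
        using integrable_subinterval_real[OF ki] xy by auto
      have "integral {0..x} (\<lambda>x. \<bar>k x\<bar>) + integral {x..y} (\<lambda>x. \<bar>k x\<bar>) = integral {0..y} (\<lambda>x. \<bar>k x\<bar>)"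
        using xy by (intro Henstock_Kurzweil_Integration.integral_combine i) auto
      moreover have "integral {0..y} (\<lambda>x. \<bar>k x\<bar>) + integral {y..2 * pi} (\<lambda>x. \<bar>k x\<bar>) = integral per_interval (\<lambda>x. \<bar>k x\<bar>)"
        using xy by (intro Henstock_Kurzweil_Integration.integral_combine ki) auto
      moreover have "\<bar>\<theta> x - \<theta> 0\<bar> \<le> integral {0..x} (\<lambda>x. \<bar>k x\<bar>)"
        "\<bar>\<theta> y - \<theta> x\<bar> \<le> integral {x..y} (\<lambda>x. \<bar>k x\<bar>)"
        "\<bar>\<theta> (2 * pi) - \<theta> y\<bar> \<le> integral {y..2 * pi} (\<lambda>x. \<bar>k x\<bar>)"
        using xy by (auto intro!: var)
      moreover have "x = p \<and> y = q \<or> x = q \<and> y = p"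
        using that(4) by (auto simp: doubleton_eq_iff)
      ultimately show ?thesis
        using per by auto
    qed
    have "2 * (\<theta> p - \<theta> q) \<le> integral per_interval (\<lambda>x. \<bar>k x\<bar>)"
      using three[of p q] three[of q p] p(1) q(1) by (cases "p \<le> q") (auto simp: insert_commute)
    then show ?thesis using osc by simp
  qed
qed

section \<open>Lifting the tangent and the optimal circle\<close>

lemma primitive_on_has_vector_derivative:
  assumes F: "primitive_on a b F f" and f: "continuous_on {a..b} f" and x: "x \<in> {a..b}"
  shows "(F has_vector_derivative f x) (at x within {a..b})"
proof -
  have "((\<lambda>u. F a + integral {a..u} f) has_vector_derivative 0 + f x) (at x within {a..b})"
    by (intro has_vector_derivative_add has_vector_derivative_const integral_has_vector_derivative f x)
  from has_vector_derivative_transform[OF x primitive_on_eq[OF F] this]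
  show ?thesis by simp
qed

text \<open>Connects the classical derivative, in which periodicity and immersion are stated, with
  the density; continuity of the density gives the identity at every point, end points
  included.\<close>

lemma dx_eq:
  assumes "primitive_on 0 (2 * pi) f g" "continuous_on per_interval g" "x \<in> per_interval"
  shows "dx f x = g x"
  unfolding dx_def
  using primitive_on_has_vector_derivative[OF assms] assms(3)
  by (intro vector_derivative_within_closed_interval) auto

text \<open>\<open>\<Theta>\<close> solves \<open>\<Theta>' = h / g\<close>, so its real part is the
  logarithm of the modulus of \<open>g\<close> and its imaginary part a continuous angle.
  \<open>Ln\<close> enters only through the initial value, so its branch cut does no harm.\<close>

lemma primitive_on_complex_lift:
  fixes g :: "real \<Rightarrow> complex"
  assumes g: "primitive_on a b g h" and nz: "\<And>x. x \<in> {a..b} \<Longrightarrow> g x \<noteq> 0"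
  obtains \<Theta> where "primitive_on a b \<Theta> (\<lambda>x. h x / g x)" "\<And>x. x \<in> {a..b} \<Longrightarrow> g x = exp (\<Theta> x)"
proof -
  have "continuous_on {a..b} (\<lambda>x. inverse (g x))"
    using primitive_on_continuous[OF g] nz by (intro continuous_on_inverse) auto
  from continuous_product_absolutely_integrable[OF bounded_bilinear_mult this
      primitive_on_absolutely_integrable[OF g]]
  have i: "(\<lambda>x. h x / g x) absolutely_integrable_on {a..b}"
    by (simp add: divide_inverse mult.commute)
  define \<Theta> where "\<Theta> x = Ln (g a) + integral {a..x} (\<lambda>x. h x / g x)" for x
  have P: "primitive_on a b \<Theta> (\<lambda>x. h x / g x)"
    using i by (simp add: primitive_on_def \<Theta>_def)
  have "primitive_on a b (\<lambda>x. - \<Theta> x) (\<lambda>x. - (h x / g x))"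
    by (rule primitive_on_bounded_linear[OF P bounded_linear_minus[OF bounded_linear_ident]])
  from primitive_on_product[OF bounded_bilinear_mult g primitive_on_exp[OF this]]
  \<comment> \<open>As \<open>g\<close> is only weakly differentiable, \<open>\<Theta>\<close> is not defined as a logarithm; instead \<open>g exp (- \<Theta>)\<close> is constant.\<close>
  have Q: "primitive_on a b (\<lambda>x. g x * exp (- \<Theta> x)) (\<lambda>x. 0)"
    by (rule primitive_on_cong) (auto simp: nz)
  have "g x * exp (- \<Theta> x) = g a * exp (- \<Theta> a)" if "x \<in> {a..b}" for x
    using primitive_on_eq[OF Q that] by simp
  moreover have "exp (\<Theta> a) = g a" if "a \<le> b"
    using nz[of a] that by (simp add: \<Theta>_def)
  ultimately have "g x * exp (- \<Theta> x) = 1" if "x \<in> {a..b}" for x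
    using that nz[of a] by (simp add: exp_minus)
  then have "g x = exp (\<Theta> x)" if "x \<in> {a..b}" for x
    using that by (simp add: exp_minus field_simps)
  then show ?thesis using that P by blast
qed

text \<open>\<open>G\<close> is the continuous representative of the weak derivative. Replacing the
  density of \<open>\<gamma>\<close> by \<open>G\<close> on a null set makes
  \<open>dx \<gamma> = G\<close> hold everywhere, which turns the pointwise conditions on
  \<open>\<gamma>\<close> into conditions on \<open>G\<close>.\<close>

lemma H2_imm_structure:
  assumes "\<gamma> \<in> H2_imm"
  obtains G h where "primitive_on 0 (2 * pi) \<gamma> G" "primitive_on 0 (2 * pi) G h" "h \<in> L2_per"
    "has_weak_deriv \<gamma> G" "\<And>x. x \<in> per_interval \<Longrightarrow> G x \<noteq> 0"
    "\<gamma> 0 = \<gamma> (2 * pi)" "G 0 = G (2 * pi)"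
proof -
  have cont: "continuous_on per_interval \<gamma>" and sob: "\<gamma> \<in> sobolev (Suc (Suc 0))"
    and per: "\<And>l. l < 2 \<Longrightarrow> (dx ^^ l) \<gamma> 0 = (dx ^^ l) \<gamma> (2 * pi)"
    and imm: "\<And>x. x \<in> per_interval \<Longrightarrow> dx \<gamma> x \<noteq> 0"
    using assms by (auto simp: H2_imm_def sobolev_per_def numeral_2_eq_2)
  from sob obtain g h where g: "has_weak_deriv \<gamma> g" and h: "has_weak_deriv g h" "h \<in> L2_per"
    by auto
  obtain G where G: "primitive_on 0 (2 * pi) G h" and AE: "AE x in per_measure. g x = G x"
    using has_weak_deriv_AE_primitive[OF h(1)] .
  note cG = primitive_on_continuous[OF G]
  have P: "primitive_on 0 (2 * pi) \<gamma> G"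
    using has_weak_deriv_continuous_primitive[OF g cont] AE
    by (rule primitive_on_cong_AE) (rule continuous_on_measurable_per[OF cG])
  have eq: "dx \<gamma> x = G x" if "x \<in> per_interval" for x
    by (rule dx_eq[OF P cG that])
  show ?thesis
  proof
    show "has_weak_deriv \<gamma> G"
      by (rule primitive_on_has_weak_deriv[OF P continuous_on_L2_per[OF cG]])
    show "G x \<noteq> 0" if "x \<in> per_interval" for x
      using imm[OF that] eq[OF that] by simp
    show "\<gamma> 0 = \<gamma> (2 * pi)" using per[of 0] by simp
    show "G 0 = G (2 * pi)" using per[of 1] eq[of 0] eq[of "2 * pi"] by simp
  qed (rule P G h(2))+
qed

text \<open>The lift of \<open>G\<close> supplies \<open>w\<close> as the exponential of its real
  part and \<open>\<theta>\<close> as its imaginary part. Square integrability of \<open>k\<close>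
  follows from that of \<open>h\<close>, since the speed is bounded below on the compact
  interval.\<close>

lemma H2_imm_framed:
  assumes "\<gamma> \<in> H2_imm"
  obtains w \<theta> k where "framed_curve \<gamma> w \<theta> k" "2 * pi \<le> (LINT x|per_measure. \<bar>k x\<bar>)"
proof -
  obtain G h where P: "primitive_on 0 (2 * pi) \<gamma> G" and G: "primitive_on 0 (2 * pi) G h"
    and h: "h \<in> L2_per" and wd: "has_weak_deriv \<gamma> G"
    and nz: "\<And>x. x \<in> per_interval \<Longrightarrow> G x \<noteq> 0"
    and ends: "\<gamma> 0 = \<gamma> (2 * pi)" "G 0 = G (2 * pi)"
    using H2_imm_structure[OF assms] by blast
  note cG = primitive_on_continuous[OF G]
  obtain \<Theta> where \<Theta>: "primitive_on 0 (2 * pi) \<Theta> (\<lambda>x. complex_of_vec (h x) / complex_of_vec (G x))"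
    and exp: "\<And>x. x \<in> per_interval \<Longrightarrow> complex_of_vec (G x) = exp (\<Theta> x)"
    using primitive_on_complex_lift[OF primitive_on_bounded_linear[OF G bounded_linear_complex_of_vec]] nz
    by (metis complex_of_vec_eq_0)
  define w where "w x = exp (Re (\<Theta> x))" for x
  define \<theta> where "\<theta> x = Im (\<Theta> x)" for x
  define k where "k x = Im (complex_of_vec (h x) / complex_of_vec (G x))" for x
  have Gw: "G x = w x *\<^sub>R circ (\<theta> x)" if "x \<in> per_interval" for x
    using arg_cong[OF exp[OF that], of vec_of_complex] by (simp add: vec_of_complex_exp w_def \<theta>_def)
  have wpos: "w x > 0" for x by (simp add: w_def)
  have wn: "w x = norm (G x)" if "x \<in> per_interval" for x
    using Gw[OF that] wpos[of x] by simp
  have \<theta>: "primitive_on 0 (2 * pi) \<theta> k"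
    unfolding \<theta>_def[abs_def] k_def[abs_def] by (rule primitive_on_bounded_linear[OF \<Theta> bounded_linear_Im])
  have wc: "continuous_on per_interval w"
    unfolding w_def[abs_def] by (intro continuous_intros primitive_on_continuous[OF \<Theta>])
  have "bounded ((\<lambda>x. inverse (w x)) ` per_interval)"
    using wc wpos by (intro compact_imp_bounded compact_continuous_image continuous_on_inverse) (auto simp: less_le)
  then obtain C where C: "\<And>x. x \<in> per_interval \<Longrightarrow> norm (inverse (w x)) \<le> C"
    unfolding bounded_iff by blast
  have kL2: "k \<in> L2_per"
  proof (rule L2_perI_bound[OF h])
    show "k \<in> borel_measurable per_measure"
      using primitive_on_absolutely_integrable[OF \<theta>] by (auto simp flip: per_integrable_iff)
    show "AE x in per_measure. norm (k x) \<le> C * norm (h x)"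
      using AE_per_in_interval
    proof eventually_elim
      case (elim x)
      have "norm (k x) \<le> norm (complex_of_vec (h x) / complex_of_vec (G x))"
        unfolding k_def by (simp only: real_norm_def abs_Im_le_cmod)
      also have "\<dots> = inverse (w x) * norm (h x)"
        unfolding norm_divide norm_complex_of_vec wn[OF elim] by (simp add: divide_inverse)
      also have "\<dots> \<le> C * norm (h x)"
        using C[OF elim] wpos[of x] by (intro mult_right_mono) auto
      finally show ?case .
    qed
  qed
  have "framed_curve \<gamma> w \<theta> k"
  proof
    show "AE x in per_measure. weak_dx \<gamma> x = w x *\<^sub>R circ (\<theta> x)"
      using weak_dx_AE_eq[OF wd] AE_per_in_interval by eventually_elim (simp add: Gw)
  qed (use weak_dx_measurable[OF wd] wc wpos \<theta> kL2 in auto)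
  moreover have "2 * pi \<le> integral per_interval (\<lambda>x. \<bar>k x\<bar>)"
  proof (rule closed_curve_total_curvature_ge[OF \<theta> wc wpos])
    have "integral per_interval (\<lambda>x. w x *\<^sub>R circ (\<theta> x)) = integral per_interval G"
      by (intro Henstock_Kurzweil_Integration.integral_cong) (simp add: Gw)
    also have "\<dots> = 0"
      using primitive_on_diff[OF P, of 0 "2 * pi"] ends by simp
    finally show "integral per_interval (\<lambda>x. w x *\<^sub>R circ (\<theta> x)) = 0" .
    \<comment> \<open>Cancelling the equal speeds from \<open>G 0 = G (2 * pi)\<close> leaves
      equality of the unit tangents, not of the angles.\<close>
    have "w 0 = w (2 * pi)"
      using ends(2) wn[of 0] wn[of "2 * pi"] by simp
    then show "circ (\<theta> 0) = circ (\<theta> (2 * pi))"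
      using ends(2) Gw[of 0] Gw[of "2 * pi"] wpos[of "2 * pi"] by simp
  qed
  moreover have "(LINT x|per_measure. \<bar>k x\<bar>) = integral per_interval (\<lambda>x. \<bar>k x\<bar>)"
    by (intro per_integral_eq integrable_abs L2_per_integrable kL2)
  ultimately show ?thesis using that by simp
qed

lemma admissible_energy_ge:
  assumes "(\<gamma>, \<eta>) \<in> admissible" "lam > 0" "R > 0" "R\<^sup>2 = lam / (2 * (lam + \<delta>\<^sup>2))"
  shows "4 * pi * R \<le> E_LM \<delta> lam \<gamma> \<eta>"
proof -
  have \<gamma>: "\<gamma> \<in> H2_imm" and \<eta>: "\<eta> \<in> sobolev (Suc 0)"
    using assms(1) by (auto simp: admissible_def sobolev_per_def)
  obtain \<zeta> where \<zeta>: "has_weak_deriv \<eta> \<zeta>" using \<eta> by auto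
  obtain w \<theta> k where f: "framed_curve \<gamma> w \<theta> k" and k: "2 * pi \<le> (LINT x|per_measure. \<bar>k x\<bar>)"
    using H2_imm_framed[OF \<gamma>] .
  have "4 * pi * R = 2 * R * (2 * pi)" by simp
  also have "\<dots> \<le> 2 * R * (LINT x|per_measure. \<bar>k x\<bar>)"
    using k \<open>R > 0\<close> by (intro mult_left_mono) auto
  also have "\<dots> \<le> E_LM \<delta> lam \<gamma> \<eta>"
    by (rule framed_curve.energy_ge_total_curvature[OF f \<zeta> assms(2-4)])
  finally show ?thesis .
qed

section \<open>The circle and its energy\<close>

text \<open>With a phase \<open>d\<close>, derivatives keep the same shape; the circle below is the case \<open>d = 0\<close>.\<close>

lemma primitive_on_scaled_circ:
  "primitive_on 0 (2 * pi) (\<lambda>x. c *\<^sub>R circ (x + d)) (\<lambda>x. c *\<^sub>R circ (x + (d + pi / 2)))"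
proof -
  have "primitive_on 0 (2 * pi) (\<lambda>x. x + d) (\<lambda>x. 1)"
    unfolding primitive_on_def by (auto intro: absolutely_integrable_continuous_real)
  from primitive_on_bounded_linear[OF primitive_on_circ[OF this] bounded_linear_scaleR_right]
  show ?thesis by (simp add: rot_circ add.assoc)
qed

lemma scaled_circ_cont: "continuous_on S (\<lambda>x. c *\<^sub>R circ (x + d))" for S :: "real set"
  by (intro continuous_intros)

lemma scaled_circ_has_weak_deriv:
  "has_weak_deriv (\<lambda>x. c *\<^sub>R circ (x + d)) (\<lambda>x. c *\<^sub>R circ (x + (d + pi / 2)))"
  by (rule primitive_on_has_weak_deriv[OF primitive_on_scaled_circ continuous_on_L2_per[OF scaled_circ_cont]])

lemma scaled_circ_sobolev: "(\<lambda>x. c *\<^sub>R circ (x + d)) \<in> sobolev n"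
proof (induction n arbitrary: d)
  case 0
  then show ?case using continuous_on_L2_per[OF scaled_circ_cont] by simp
next
  case (Suc n)
  then show ?case using scaled_circ_has_weak_deriv by auto
qed

lemma circ_periodic: "circ (2 * pi + t) = circ t"
  by (simp add: vec_eq_iff forall_2 cos_add sin_add)

lemma scaled_circ_dx: "x \<in> per_interval \<Longrightarrow> dx (\<lambda>x. c *\<^sub>R circ (x + d)) x = c *\<^sub>R circ (x + (d + pi / 2))"
  by (rule dx_eq[OF primitive_on_scaled_circ scaled_circ_cont])

lemma scaled_circ_sobolev_per:
  assumes "n \<le> 2"
  shows "(\<lambda>x. c *\<^sub>R circ (x + d)) \<in> sobolev_per n"
proof -
  have "(dx ^^ l) (\<lambda>x. c *\<^sub>R circ (x + d)) 0 = (dx ^^ l) (\<lambda>x. c *\<^sub>R circ (x + d)) (2 * pi)"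
    if "l < n" for l
  proof -
    have "dx (\<lambda>x. c *\<^sub>R circ (x + d)) 0 = dx (\<lambda>x. c *\<^sub>R circ (x + d)) (2 * pi)"
      using scaled_circ_dx[of 0 c d] scaled_circ_dx[of "2 * pi" c d] by (simp only: circ_periodic) simp
    moreover have "l = 0 \<or> l = 1" using that assms by auto
    ultimately show ?thesis by (auto simp: circ_periodic)
  qed
  then show ?thesis
    by (simp add: sobolev_per_def scaled_circ_sobolev scaled_circ_cont)
qed

lemma scaled_circ_integral: "(LINT x|per_measure. c *\<^sub>R circ (x + d)) = 0"
proof -
  \<comment> \<open>The field with phase \<open>d\<close> is the derivative of the one with phase
    \<open>d - pi / 2\<close>, whose values at the two end points agree.\<close>
  have "c *\<^sub>R circ (2 * pi + (d - pi / 2)) - c *\<^sub>R circ (0 + (d - pi / 2)) =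
      integral per_interval (\<lambda>x. c *\<^sub>R circ (x + ((d - pi / 2) + pi / 2)))"
    by (rule primitive_on_diff[OF primitive_on_scaled_circ]) auto
  then have "integral per_interval (\<lambda>x. c *\<^sub>R circ (x + d)) = 0"
    unfolding circ_periodic by (simp del: Henstock_Kurzweil_Integration.integral_cmul)
  then show ?thesis
    using per_integral_eq[OF continuous_on_per_integrable[OF scaled_circ_cont]] by metis
qed

text \<open>The unit normal of the circle is \<open>- circ x\<close>, so the second component is a
  multiple of the normal field. The phase 0 is kept explicit so that the lemmas on
  \<open>circ (x + d)\<close> match syntactically.\<close>

lemma circle_admissible:
  assumes "R > 0"
  shows "((\<lambda>x. R *\<^sub>R circ (x + 0)), (\<lambda>x. c *\<^sub>R circ (x + 0))) \<in> admissible"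
  using assms scaled_circ_sobolev_per[of 2 R 0] scaled_circ_sobolev_per[of 1 c 0]
    scaled_circ_integral[of R 0] scaled_circ_integral[of c 0] scaled_circ_dx[of _ R 0]
  unfolding admissible_def H2_imm_def by auto

text \<open>The weak derivative of the field is \<open>c\<close> times the unit tangent, so all
  three integrands are constant: the tangential part and the norm of the derivative are
  \<open>c\<close> and \<open>\<bar>c\<bar>\<close>.\<close>

lemma circle_energy:
  assumes "R > 0"
  shows "E_LM \<delta> lam (\<lambda>x. R *\<^sub>R circ (x + 0)) (\<lambda>x. c *\<^sub>R circ (x + 0)) =
    pi * ((1 + \<delta> * c)\<^sup>2 + lam * c\<^sup>2) / R + 2 * pi * R"
proof -
  \<comment> \<open>Speed \<open>R\<close>, tangent angle \<open>x + pi / 2\<close> and angular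
    density 1. The form \<open>0 + pi / 2\<close> is what \<open>scaled_circ_has_weak_deriv\<close>
    yields for phase 0.\<close>
  interpret framed_curve "\<lambda>x. R *\<^sub>R circ (x + 0)" "\<lambda>x. R" "\<lambda>x. x + (0 + pi / 2)" "\<lambda>x. 1"
  proof
    note wd = scaled_circ_has_weak_deriv[of R 0]
    show "AE x in per_measure. weak_dx (\<lambda>x. R *\<^sub>R circ (x + 0)) x = R *\<^sub>R circ (x + (0 + pi / 2))"
      by (rule weak_dx_AE_eq[OF wd])
    show "weak_dx (\<lambda>x. R *\<^sub>R circ (x + 0)) \<in> borel_measurable per_measure"
      by (rule weak_dx_measurable[OF wd])
    show "primitive_on 0 (2 * pi) (\<lambda>x. x + (0 + pi / 2)) (\<lambda>x. 1)"
      unfolding primitive_on_def by (auto intro: absolutely_integrable_continuous_real)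
    show "(\<lambda>x. 1) \<in> L2_per" by (rule continuous_on_L2_per) simp
  qed (use assms in auto)
  have const: "(LINT x|per_measure. t) = 2 * pi * t" for t :: real
    using per_integral_eq[OF continuous_on_per_integrable[OF continuous_on_const[of _ t]]] by simp
  show ?thesis
    unfolding energy_terms(4)[OF scaled_circ_has_weak_deriv]
    by (simp add: const inner_scaleR_left power2_abs del: lebesgue_integral_const)
      (simp add: add_divide_distrib distrib_left)
qed

theorem theorem3p1:
  fixes \<delta> lam :: real
  assumes "lam > 0"
  shows "\<exists>\<gamma> \<eta>. (\<gamma>, \<eta>) \<in> admissible \<and>
           (\<forall>\<gamma>' \<eta>'. (\<gamma>', \<eta>') \<in> admissible \<longrightarrow> E_LM \<delta> lam \<gamma> \<eta> \<le> E_LM \<delta> lam \<gamma>' \<eta>')"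
proof -
  define S where "S = lam + \<delta>\<^sup>2"
  define R where "R = sqrt (lam / (2 * S))"
  \<comment> \<open>The minimum point of \<open>(1 + \<delta> t)^2 + lam t^2\<close>, which makes
    the completed square vanish for the circle, where \<open>k = 1\<close>.\<close>
  define c where "c = - \<delta> / S"
  have S: "S > 0" using assms by (simp add: S_def add_pos_nonneg)
  have R: "R > 0" using assms S by (simp add: R_def)
  have R2: "R\<^sup>2 = lam / (2 * S)" using assms S by (simp add: R_def)
  have "1 + \<delta> * c = lam / S"
    using S by (simp add: c_def S_def power2_eq_square field_simps)
  then have "(1 + \<delta> * c)\<^sup>2 + lam * c\<^sup>2 = (lam / S)\<^sup>2 + lam * (\<delta> / S)\<^sup>2"
    by (simp only: c_def) (simp add: power2_eq_square)
  also have "\<dots> = lam * (lam + \<delta>\<^sup>2) / S\<^sup>2"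
    by (simp add: power_divide power2_eq_square add_divide_distrib distrib_left)
  also have "\<dots> = 2 * R\<^sup>2"
    unfolding R2 S_def[symmetric] by (simp add: power2_eq_square)
  finally have opt: "(1 + \<delta> * c)\<^sup>2 + lam * c\<^sup>2 = 2 * R\<^sup>2" .
  \<comment> \<open>With \<open>opt\<close>, the quadratic terms contribute
    \<open>2 * pi * R\<close>, exactly as much as the length: the equality case of AM-GM.\<close>
  have "E_LM \<delta> lam (\<lambda>x. R *\<^sub>R circ (x + 0)) (\<lambda>x. c *\<^sub>R circ (x + 0)) = 4 * pi * R"
    unfolding circle_energy[OF R] opt using R by (simp add: power2_eq_square)
  then show ?thesis
    using circle_admissible[OF R, of c] admissible_energy_ge[OF _ assms R R2[unfolded S_def]]
    by metis
qed

end
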